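(* Let $(\mathcal F(x)_{x\in A^0},(T_\lambda)_{\lambda\in\nabla})$ be a vertex coefficient system on $A^0$ over a ring $R$, let $\alpha=(\alpha_\lambda)_{\lambda\in\nabla}$ with $\alpha_\lambda\in R$, and let $C_\alpha\mathcal F^\bullet$ be the associated Koszul complex. Let $\epsilon\in\mathbb R$. (a) $C_\alpha\mathcal F^\bullet_\epsilon$ and $C_\alpha\mathcal F^\bullet_{\epsilon-}$ are subcomplexes of $C_\alpha\mathcal F^\bullet$, i.e. they are respected by the differential of $C_\alpha\mathcal F^\bullet$. (b) The differential on the quotient $\overline C\mathcal F^\bullet_\epsilon=C_\alpha\mathcal F^\bullet_\epsilon/C_\alpha\mathcal F^\bullet_{\epsilon-}$ is independent of the collection $\alpha$. (c) If $\epsilon\in\mathcal E$ we have $$\overline C\mathcal F^\bullet_\epsilon=\bigoplus_{(z,Q)\in\mathfrak P(\epsilon)}\mathcal F(z)\otimes\bigwedge_{\lambda\in Q}\lambda,$$ where the differentials on this complex are induced from those of $C_\alpha\mathcal F^\bullet$ by composing with the inclusion maps $\mathcal F(z)\to\mathcal F(A^0)$ on the one hand, and the projection maps $\mathcal F(A^0)\to\mathcal F(z)$ on the other hand.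
   Context: **Apartment.** Let $\mathbf T$ be a split maximal torus of a split semisimple group of adjoint type, with root system $\Phi$ and Weyl group $W$; $X_*(\mathbf T)$ is the coweight lattice, $\nabla$ the set of fundamental coweights for a choice of positive roots (a $\mathbb Z$-basis of $X_*(\mathbf T)$). $A=X_*(\mathbf T)\otimes\mathbb R$ with a $W$-invariant Euclidean norm $\|\cdot\|$ and origin $x_0$; $W$ acts linearly, $X_*(\mathbf T)$ by translations; $A^0\subset A$, the set of special vertices, is the lattice $X_*(\mathbf T)$ (the orbit of $x_0$). Walls through $x_0$ are the hyperplanes spanned by $w(\nabla-\{\lambda\})$ ($w\in W$, $\lambda\in\nabla$); walls are the $X_*(\mathbf T)$-translates of these. $\overline C=\{\sum_{\lambda\in\nabla}r_\lambda\lambda: r_\lambda\ge0\}$; $\sigma_0$ is the chamber (connected component of the complement of all walls) contained in $\overline C$ whose closure contains $x_0$. Fix $z_0\in\sigma_0$ such that no two different elements of $A^0$ have the same distance from $z_0$. $\mathcal E$ is the set of $\epsilon$ for which there is a (unique) $z_\epsilon\in A^0$ with $\|z_\epsilon-z_0\|=\epsilon$. For $z\in A^0$ let $w_z\in W$ be the unique element with $z\in z_0-w_z\overline C$. For $\epsilon\in\mathcal E$ put $Q(\epsilon)=\{\lambda\in\nabla: z_\epsilon+w_{z_\epsilon}\lambda\in z_0-w_{z_\epsilon}\overline C\}$. Put $\mathfrak P=\{(z,Q): z\in A^0,\ Q\subset\nabla\}$, $$\epsilon(z,Q)=\max\Bigl\{\bigl\|z-\sum_{\lambda\in Q}w_\lambda\lambda-z_0\bigr\|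 : (w_\lambda)_{\lambda\in Q}\in W^Q\Bigr\},\qquad \mathfrak P(\epsilon)=\Bigl\{\bigl(z_\epsilon+\sum_{\lambda\in Q}w_{z_\epsilon}\lambda,\ Q\bigr): Q\subset Q(\epsilon)\Bigr\}.$$ **Vertex coefficient systems.** For $x\in A^0$, $\lambda\in\nabla$ let $\mathcal B_\lambda(x)$ be the set of all $x+w(-\lambda)$, $w\in W$, together with all $s(x+w(-\lambda))$ with $w\in W$ and $s$ the reflection in an affine wall of $A$ which separates $x$ both from $x+w(-\lambda)$ and from $\sigma_0$. A vertex coefficient system on $A^0$ over $R$ consists of an $R$-module $\mathcal F(x)$ for each $x\in A^0$ (put $\mathcal F(Y)=\bigoplus_{y\in Y}\mathcal F(y)$ for $Y\subset A^0$) and pairwise commuting $R$-endomorphisms $T_\lambda$ ($\lambda\in\nabla$) of $\mathcal F(A^0)$ with $T_\lambda(\mathcal F(x))\subset\mathcal F(\mathcal B_\lambda(x))$ for all $x$. **Koszul complex and filtration.** $\mathbb Z[\nabla]$ is the free $\mathbb Z$-module on $\nabla$. $C_\alpha\mathcal F^j=\mathcal F(A^0)\otimes\bigwedge^j\mathbb Z[\nabla]$ with differential $C_\alpha\mathcal F^{j+1}\to C_\alpha\mathcal F^j$, $f\otimes(\lambda_1\wedge\dots\wedge\lambda_{j+1})\mapsto\sum_s(-1)^s(T_{\lambda_s}(f)-\alpha_{\lambda_s}f)\otimes(\lambda_1\wedge\dots\widehat{\lambda_s}\dots\wedge\lambda_{j+1})$. Put $$C_\alpha\mathcal F^\bullet_\epsilon=\bigoplus_{\epsilon(z,Q)\le\epsilon}\mathcal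 F(z)\otimes\bigwedge_{\lambda\in Q}\lambda,\qquad C_\alpha\mathcal F^\bullet_{\epsilon-}=\bigoplus_{\epsilon(z,Q)<\epsilon}\mathcal F(z)\otimes\bigwedge_{\lambda\in Q}\lambda$$ (sums over $(z,Q)\in\mathfrak P$), where $\bigwedge_{\lambda\in Q}\lambda$ stands for the rank one summand of $\bigwedge^{|Q|}\mathbb Z[\nabla]$ it generates. *)

theory Defs
  imports "HOL-Analysis.Analysis" "HOL-Library.Poly_Mapping" "HOL-Library.Set_Algebras"
begin

section \<open>The apartment\<close>

text \<open>
  The apartment is a finite dimensional real inner product space of type \<open>'a\<close> (finite dimensional
  because it is spanned by the finite set of roots; dimension 0 is allowed).  A root is identified,
  by means of the invariant inner product, with the vector \<open>a\<close> such that the root is the linear form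
  \<open>\<lambda>x. a \<bullet> x\<close>; its coroot is then \<open>(2 / (a \<bullet> a)) *\<^sub>R a\<close>, and invariance of the inner product under
  the Weyl group says exactly that the root reflections are the orthogonal reflections.
\<close>

definition root_reflection :: "'a::real_inner \<Rightarrow> 'a \<Rightarrow> 'a" where
  "root_reflection a x = x - (2 * (a \<bullet> x) / (a \<bullet> a)) *\<^sub>R a"

locale root_system =
  fixes Phi :: "'a::real_inner set"
  assumes finite_roots: "finite Phi"
    and zero_not_root: "0 \<notin> Phi"
    and span_roots: "span Phi = UNIV"
    and reflection_root: "a \<in> Phi \<Longrightarrow> b \<in> Phi \<Longrightarrow> root_reflection a b \<in> Phi"
    and cartan_integer: "a \<in> Phi \<Longrightarrow> b \<in> Phi \<Longrightarrow> 2 * (a \<bullet> b) / (a \<bullet> a) \<in> \<int>"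
    and reduced: "a \<in> Phi \<Longrightarrow> c *\<^sub>R a \<in> Phi \<Longrightarrow> c = 1 \<or> c = - 1"

text \<open>
  A choice of positive roots is given by its set \<open>Delta\<close> of simple roots: the positive roots are the
  roots that are non-negative integral combinations of \<open>Delta\<close>.
\<close>

definition root_base :: "'a::real_inner set \<Rightarrow> 'a set \<Rightarrow> bool" where
  "root_base Phi Delta \<longleftrightarrow> Delta \<subseteq> Phi \<and> independent Delta \<and>
     (\<forall>b\<in>Phi. \<exists>n :: 'a \<Rightarrow> nat. b = (\<Sum>a\<in>Delta. real (n a) *\<^sub>R a) \<or>
                               b = - (\<Sum>a\<in>Delta. real (n a) *\<^sub>R a))"

inductive_set weyl :: "'a::real_inner set \<Rightarrow> ('a \<Rightarrow> 'a) set" for Phi where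
  "id \<in> weyl Phi"
| "a \<in> Phi \<Longrightarrow> w \<in> weyl Phi \<Longrightarrow> root_reflection a \<circ> w \<in> weyl Phi"

text \<open>
  For a group of adjoint type the character lattice is the root lattice, so the cocharacter lattice
  is the set of all vectors on which every root is integral.  The origin of the apartment is \<open>0\<close>, and
  this lattice is also the set of special vertices.
\<close>

definition coweight_lattice :: "'a::real_inner set \<Rightarrow> 'a set" where
  "coweight_lattice Phi = {x. \<forall>a\<in>Phi. a \<bullet> x \<in> \<int>}"

definition nabla :: "'a::real_inner set \<Rightarrow> 'a set" where
  "nabla Delta = {l. \<exists>a\<in>Delta. a \<bullet> l = 1 \<and> (\<forall>b\<in>Delta - {a}. b \<bullet> l = 0)}"

definition closed_cone :: "'a::real_inner set \<Rightarrow> 'a set" where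
  "closed_cone Delta = {\<Sum>l\<in>nabla Delta. r l *\<^sub>R l | r. \<forall>l\<in>nabla Delta. 0 \<le> r l}"

definition walls :: "'a::real_inner set \<Rightarrow> 'a set \<Rightarrow> 'a set set" where
  "walls Phi Delta = {(\<lambda>x. t + x) ` span (w ` (nabla Delta - {l})) | t w l.
     t \<in> coweight_lattice Phi \<and> w \<in> weyl Phi \<and> l \<in> nabla Delta}"

locale apartment = root_system Phi
  for Phi :: "'a::real_inner set" +
  fixes Delta :: "'a set" and sigma0 :: "'a set" and z0 :: 'a
  assumes base: "root_base Phi Delta"
    and sigma0_chamber: "sigma0 \<in> components (- \<Union>(walls Phi Delta))"
    and sigma0_in_cone: "sigma0 \<subseteq> closed_cone Delta"
    and origin_in_closure: "0 \<in> closure sigma0"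
    and z0_in_sigma0: "z0 \<in> sigma0"
    and z0_generic: "y \<in> coweight_lattice Phi \<Longrightarrow> z \<in> coweight_lattice Phi \<Longrightarrow>
                       norm (y - z0) = norm (z - z0) \<Longrightarrow> y = z"

definition calE :: "'a::real_inner set \<Rightarrow> 'a \<Rightarrow> real set" where
  "calE Phi z0 = {eps. \<exists>z\<in>coweight_lattice Phi. norm (z - z0) = eps}"

definition z_eps :: "'a::real_inner set \<Rightarrow> 'a \<Rightarrow> real \<Rightarrow> 'a" where
  "z_eps Phi z0 eps = (THE z. z \<in> coweight_lattice Phi \<and> norm (z - z0) = eps)"

text \<open>
  For a lattice point \<open>z\<close> the Weyl group element with the following property is unique, since
  \<open>z0 - z\<close> lies on no wall through the origin.
\<close>

definition w_of :: "'a::real_inner set \<Rightarrow> 'a set \<Rightarrow> 'a \<Rightarrow> 'a \<Rightarrow> 'a \<Rightarrow> 'a" where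
  "w_of Phi Delta z0 z = (SOME w. w \<in> weyl Phi \<and> z \<in> (\<lambda>c. z0 - w c) ` closed_cone Delta)"

definition Q_eps :: "'a::real_inner set \<Rightarrow> 'a set \<Rightarrow> 'a \<Rightarrow> real \<Rightarrow> 'a set" where
  "Q_eps Phi Delta z0 eps =
     (let z = z_eps Phi z0 eps; w = w_of Phi Delta z0 z
      in {l \<in> nabla Delta. z + w l \<in> (\<lambda>c. z0 - w c) ` closed_cone Delta})"

definition pairs :: "'a::real_inner set \<Rightarrow> 'a set \<Rightarrow> ('a \<times> 'a set) set" where
  "pairs Phi Delta = coweight_lattice Phi \<times> Pow (nabla Delta)"

definition eps_of :: "'a::real_inner set \<Rightarrow> 'a \<Rightarrow> 'a \<Rightarrow> 'a set \<Rightarrow> real" where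
  "eps_of Phi z0 z Q = Max {norm (z - (\<Sum>l\<in>Q. w l l) - z0) | w. \<forall>l\<in>Q. w l \<in> weyl Phi}"

definition pairs_eps :: "'a::real_inner set \<Rightarrow> 'a set \<Rightarrow> 'a \<Rightarrow> real \<Rightarrow> ('a \<times> 'a set) set" where
  "pairs_eps Phi Delta z0 eps =
     (let z = z_eps Phi z0 eps; w = w_of Phi Delta z0 z
      in {(z + (\<Sum>l\<in>Q. w l), Q) | Q. Q \<subseteq> Q_eps Phi Delta z0 eps})"


section \<open>Vertex coefficient systems\<close>

definition wall_separates :: "'a::real_vector set \<Rightarrow> 'a \<Rightarrow> 'a set \<Rightarrow> bool" where
  "wall_separates H x Y \<longleftrightarrow> x \<notin> H \<and> (\<forall>y\<in>Y. y \<notin> H \<and> closed_segment x y \<inter> H \<noteq> {})"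

definition wall_reflection :: "'a::real_inner set \<Rightarrow> 'a \<Rightarrow> 'a" where
  "wall_reflection H x =
     (THE y. midpoint x y \<in> H \<and> (\<forall>p\<in>H. \<forall>q\<in>H. (y - x) \<bullet> (p - q) = 0))"

definition calB :: "'a::real_inner set \<Rightarrow> 'a set \<Rightarrow> 'a set \<Rightarrow> 'a \<Rightarrow> 'a \<Rightarrow> 'a set" where
  "calB Phi Delta sigma0 l x =
     {x + w (- l) | w. w \<in> weyl Phi} \<union>
     {wall_reflection H (x + w (- l)) | H w. w \<in> weyl Phi \<and> H \<in> walls Phi Delta \<and>
        wall_separates H x {x + w (- l)} \<and> wall_separates H x sigma0}"

text \<open>
  The \<open>R\<close>-modules \<open>F x\<close> are submodules of one ambient module on the type \<open>'b\<close>.  This is no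
  restriction: a family of modules embeds into its direct sum.
  Elements of direct sums are finitely supported functions.
\<close>

definition direct_sum :: "('a \<Rightarrow> 'b::zero set) \<Rightarrow> 'a set \<Rightarrow> ('a \<Rightarrow>\<^sub>0 'b) set" where
  "direct_sum F Y =
     {f. \<forall>y\<in>Poly_Mapping.keys f. y \<in> Y \<and> Poly_Mapping.lookup f y \<in> F y}"

definition dscale :: "('r \<Rightarrow> 'b::zero \<Rightarrow> 'b) \<Rightarrow> 'r \<Rightarrow> ('a \<Rightarrow>\<^sub>0 'b) \<Rightarrow> ('a \<Rightarrow>\<^sub>0 'b)" where
  "dscale smul r = Poly_Mapping.map (smul r)"

locale vertex_coefficient_system = apartment Phi Delta sigma0 z0 + module smul
  for Phi Delta sigma0 and z0 :: "'a::real_inner"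
    and smul :: "'r::comm_ring_1 \<Rightarrow> 'b::ab_group_add \<Rightarrow> 'b" +
  fixes F :: "'a \<Rightarrow> 'b set" and T :: "'a \<Rightarrow> ('a \<Rightarrow>\<^sub>0 'b) \<Rightarrow> ('a \<Rightarrow>\<^sub>0 'b)"
  assumes F_module: "x \<in> coweight_lattice Phi \<Longrightarrow> module.subspace smul (F x)"
    and T_closed: "l \<in> nabla Delta \<Longrightarrow> f \<in> direct_sum F (coweight_lattice Phi) \<Longrightarrow>
          T l f \<in> direct_sum F (coweight_lattice Phi)"
    and T_add: "l \<in> nabla Delta \<Longrightarrow> f \<in> direct_sum F (coweight_lattice Phi) \<Longrightarrow>
          g \<in> direct_sum F (coweight_lattice Phi) \<Longrightarrow> T l (f + g) = T l f + T l g"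
    and T_scale: "l \<in> nabla Delta \<Longrightarrow> f \<in> direct_sum F (coweight_lattice Phi) \<Longrightarrow>
          T l (dscale smul r f) = dscale smul r (T l f)"
    and T_commute: "l \<in> nabla Delta \<Longrightarrow> m \<in> nabla Delta \<Longrightarrow>
          f \<in> direct_sum F (coweight_lattice Phi) \<Longrightarrow> T l (T m f) = T m (T l f)"
    and T_local: "l \<in> nabla Delta \<Longrightarrow> x \<in> coweight_lattice Phi \<Longrightarrow> f \<in> direct_sum F {x} \<Longrightarrow>
          T l f \<in> direct_sum F (calB Phi Delta sigma0 l x)"


section \<open>The Koszul complex and its filtration\<close>

text \<open>
  Let \<open>num\<close> be a numbering of the fundamental coweights.  The exterior algebra of the free
  \<open>\<int>\<close>-module on \<open>nabla\<close> has the basis consisting of the \<open>e\<^sub>Q = l\<^sub>1 \<and> \<dots> \<and> l\<^sub>j\<close>, where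
  \<open>Q = {l\<^sub>1, \<dots>, l\<^sub>j} \<subseteq> nabla\<close> with \<open>num l\<^sub>1 < \<dots> < num l\<^sub>j\<close>.  A chain \<open>\<Sum>\<^sub>Q f\<^sub>Q \<otimes> e\<^sub>Q\<close> is represented by
  the finitely supported function \<open>Q \<mapsto> f\<^sub>Q\<close>; so \<open>f \<otimes> e\<^sub>Q\<close> is \<open>Poly_Mapping.single Q f\<close>.
  The exponent of \<open>-1\<close> in the differential is the position of \<open>l\<close> in \<open>Q\<close>, counted from 1.
  For \<open>f \<otimes> (l\<^sub>1 \<and> \<dots> \<and> l\<^sub>j)\<close> with the \<open>l\<^sub>i\<close> in arbitrary order and possibly repeated see
  \<open>tensor_wedge\<close> and \<open>koszul_d_tensor_wedge\<close> below.
\<close>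

type_synonym ('a, 'b) chain = "'a set \<Rightarrow>\<^sub>0 'a \<Rightarrow>\<^sub>0 'b"

definition koszul_d :: "('a \<Rightarrow> nat) \<Rightarrow> ('r::comm_ring_1 \<Rightarrow> 'b::ab_group_add \<Rightarrow> 'b) \<Rightarrow>
    ('a \<Rightarrow> ('a \<Rightarrow>\<^sub>0 'b) \<Rightarrow> ('a \<Rightarrow>\<^sub>0 'b)) \<Rightarrow> ('a \<Rightarrow> 'r) \<Rightarrow> ('a, 'b) chain \<Rightarrow> ('a, 'b) chain" where
  "koszul_d num smul T alpha c =
     (\<Sum>Q\<in>Poly_Mapping.keys c. \<Sum>l\<in>Q.
        Poly_Mapping.single (Q - {l})
          (dscale smul ((- 1) ^ card {m \<in> Q. num m \<le> num l})
            (T l (Poly_Mapping.lookup c Q) - dscale smul (alpha l) (Poly_Mapping.lookup c Q))))"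

text \<open>
  The differential is given by the Koszul formula on \<open>f \<otimes> (l\<^sub>1 \<and> \<dots> \<and> l\<^sub>j)\<close> for arbitrary
  \<open>l\<^sub>1, \<dots>, l\<^sub>j\<close>; in particular it does not depend on \<open>num\<close> when chains are identified with
  elements of the tensor product with the exterior algebra.
\<close>

fun wedge_sign :: "('a \<Rightarrow> nat) \<Rightarrow> 'a list \<Rightarrow> 'r::comm_ring_1" where
  "wedge_sign num [] = 1"
| "wedge_sign num (l # ls) = (- 1) ^ card {m \<in> set ls. num m < num l} * wedge_sign num ls"

definition tensor_wedge :: "('a \<Rightarrow> nat) \<Rightarrow> ('r::comm_ring_1 \<Rightarrow> 'b::ab_group_add \<Rightarrow> 'b) \<Rightarrow>
    ('a \<Rightarrow>\<^sub>0 'b) \<Rightarrow> 'a list \<Rightarrow> ('a, 'b) chain" where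
  "tensor_wedge num smul f ls =
     (if distinct ls then Poly_Mapping.single (set ls) (dscale smul (wedge_sign num ls) f) else 0)"

lemma wedge_sign_swap:
  assumes "num x \<noteq> num y" "x \<notin> set ls" "y \<notin> set ls"
  shows "wedge_sign num (x # y # ls) = - (wedge_sign num (y # x # ls) :: 'r::comm_ring_1)"
proof -
  have *: "card {m \<in> set (b # ls). num m < num a} =
      card {m \<in> set ls. num m < num a} + (if num b < num a then 1 else 0)"
    if "b \<notin> set ls" for a b
  proof -
    have "{m \<in> set (b # ls). num m < num a} =
        (if num b < num a then insert b {m \<in> set ls. num m < num a} else {m \<in> set ls. num m < num a})"
      by auto
    then show ?thesis using that by simp
  qed
  show ?thesis
    unfolding wedge_sign.simps *[OF assms(2)] *[OF assms(3)]
    using assms(1) by (auto simp: not_less algebra_simps)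
qed

lemma wedge_sign_move:
  assumes "distinct (xs @ x # ys)" "inj_on num (set (xs @ x # ys))"
  shows "wedge_sign num (xs @ x # ys) =
    (- 1) ^ length xs * (wedge_sign num (x # xs @ ys) :: 'r::comm_ring_1)"
  using assms
proof (induction xs)
  case (Cons a xs)
  have ne: "num a \<noteq> num x"
    using Cons.prems by (auto simp: inj_on_def)
  have "set (xs @ x # ys) = set (x # xs @ ys)" by auto
  then have "wedge_sign num ((a # xs) @ x # ys) =
      (- 1) ^ length xs * (wedge_sign num (a # x # xs @ ys) :: 'r)"
    using Cons by (simp add: inj_on_def mult.left_commute)
  also have "wedge_sign num (a # x # xs @ ys) = - (wedge_sign num (x # a # xs @ ys) :: 'r)"
    by (rule wedge_sign_swap) (use Cons.prems ne in auto)
  finally show ?case by simp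
qed simp

lemma wedge_sign_square: "wedge_sign num ls * wedge_sign num ls = (1 :: 'r::comm_ring_1)"
proof (induction ls)
  case (Cons l ls)
  have "((- 1) ^ n * w) * ((- 1) ^ n * w) = w * w" for n and w :: 'r
    by (simp add: minus_one_power_iff)
  then show ?case using Cons by simp
qed simp

context module
begin

lemma lookup_dscale: "Poly_Mapping.lookup (dscale scale r f) k = scale r (Poly_Mapping.lookup f k)"
  by (simp add: dscale_def Poly_Mapping.map.rep_eq when_def)

lemma dscale_dscale: "dscale scale r (dscale scale s f) = dscale scale (r * s) f"
  by (rule poly_mapping_eqI) (simp add: lookup_dscale)

lemma dscale_diff: "dscale scale r (f - g) = dscale scale r f - dscale scale r g"
  by (rule poly_mapping_eqI) (simp add: lookup_dscale lookup_minus scale_right_diff_distrib)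

lemma dscale_zero [simp]: "dscale scale r 0 = 0"
  by (rule poly_mapping_eqI) (simp add: lookup_dscale)

lemma dscale_zero_left [simp]: "dscale scale 0 f = 0"
  by (rule poly_mapping_eqI) (simp add: lookup_dscale)

lemma dscale_one [simp]: "dscale scale 1 f = f"
  by (rule poly_mapping_eqI) (simp add: lookup_dscale)

lemma dscale_uminus: "dscale scale (- r) f = - dscale scale r f"
  by (rule poly_mapping_eqI) (simp add: lookup_dscale)

lemma koszul_d_tensor_wedge:
  fixes num :: "'c \<Rightarrow> nat" and f :: "'c \<Rightarrow>\<^sub>0 'b"
  assumes T: "\<And>l r. l \<in> set ls \<Longrightarrow> T l (dscale scale r f) = dscale scale r (T l f)"
    and num: "inj_on num (set ls)"
  shows "koszul_d num scale T alpha (tensor_wedge num scale f ls) =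
    (\<Sum>i<length ls. tensor_wedge num scale
       (dscale scale ((- 1) ^ Suc i) (T (ls ! i) f - dscale scale (alpha (ls ! i)) f))
       (take i ls @ drop (Suc i) ls))"
proof (cases "distinct ls")
  case True
  define g where "g l = T l f - dscale scale (alpha l) f" for l
  define s where "s = (wedge_sign num ls :: 'a)"
  define e where "e l = card {m \<in> set ls. num m \<le> num l}" for l
  have monom: "Poly_Mapping.single (set ls - {ls ! i})
        (dscale scale ((- 1) ^ e (ls ! i)) (dscale scale s (g (ls ! i)))) =
      tensor_wedge num scale (dscale scale ((- 1) ^ Suc i) (g (ls ! i))) (take i ls @ drop (Suc i) ls)"
    if i: "i < length ls" for i
  proof -
    define xs x ys where "xs = take i ls" and "x = ls ! i" and "ys = drop (Suc i) ls"
    have ls: "ls = xs @ x # ys"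
      using i by (simp add: xs_def x_def ys_def id_take_nth_drop)
    have len: "length xs = i" using i by (simp add: xs_def)
    have x: "x \<notin> set (xs @ ys)" and d: "distinct (xs @ ys)"
      using True ls by auto
    have "{m \<in> set ls. num m \<le> num x} = insert x {m \<in> set (xs @ ys). num m < num x}"
      using num x by (auto simp: ls inj_on_def le_less)
    then have e: "e x = Suc (card {m \<in> set (xs @ ys). num m < num x})"
      using x by (simp add: e_def)
    have "s = (- 1) ^ i * wedge_sign num (x # xs @ ys)"
      unfolding s_def ls using wedge_sign_move[of xs x ys num] True num len by (simp add: ls)
    then have "(- 1) ^ e x * s = wedge_sign num (xs @ ys) * (- 1) ^ Suc i"
      by (simp add: e minus_one_power_iff split: if_splits)
    moreover have "set ls - {x} = set (xs @ ys)" using x by (auto simp: ls)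
    ultimately show ?thesis
      using d by (simp add: tensor_wedge_def dscale_dscale x_def[symmetric] xs_def[symmetric]
          ys_def[symmetric])
  qed
  have "koszul_d num scale T alpha (tensor_wedge num scale f ls) =
      (\<Sum>l\<in>set ls. Poly_Mapping.single (set ls - {l})
        (dscale scale ((- 1) ^ e l) (dscale scale s (g l))))"
  proof (cases "dscale scale s f = 0")
    case True
    have "f = dscale scale (s * s) f"
      by (simp add: s_def wedge_sign_square)
    then have f: "f = 0"
      using True by (simp flip: dscale_dscale)
    have "T l 0 = 0" if "l \<in> set ls" for l
      using T[OF that, of 0] by (simp add: f)
    then have "g l = 0" if "l \<in> set ls" for l
      using that by (simp add: g_def f)
    then show ?thesis
      using \<open>distinct ls\<close> True
      by (simp add: koszul_d_def tensor_wedge_def s_def)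
  next
    case False
    then show ?thesis
      using \<open>distinct ls\<close>
      by (simp add: koszul_d_def tensor_wedge_def s_def[symmetric] g_def e_def T dscale_diff
          dscale_dscale mult.commute mult.left_commute)
  qed
  also have "\<dots> = (\<Sum>i<length ls. Poly_Mapping.single (set ls - {ls ! i})
        (dscale scale ((- 1) ^ e (ls ! i)) (dscale scale s (g (ls ! i)))))"
    by (rule sum.reindex_bij_betw[OF bij_betw_nth, symmetric]) (use True in auto)
  also have "\<dots> = (\<Sum>i<length ls. tensor_wedge num scale (dscale scale ((- 1) ^ Suc i) (g (ls ! i)))
      (take i ls @ drop (Suc i) ls))"
    by (rule sum.cong) (use monom in auto)
  finally show ?thesis by (simp add: g_def)
next
  case False
  then obtain xs ys zs x where ls: "ls = xs @ [x] @ ys @ [x] @ zs"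
    using not_distinct_decomp by blast
  define g where "g l = T l f - dscale scale (alpha l) f" for l
  define h where "h i = tensor_wedge num scale (dscale scale ((- 1) ^ Suc i) (g (ls ! i)))
      (take i ls @ drop (Suc i) ls)" for i
  define i j where "i = length xs" and "j = length xs + Suc (length ys)"
  have ij: "i < length ls" "j < length ls" "i \<noteq> j" by (auto simp: i_def j_def ls)
  have zero: "h k = 0" if k: "k < length ls" "k \<noteq> i" "k \<noteq> j" for k
  proof -
    define p where "p m = (if m < k then m else m - 1)" for m
    have p: "(take k ls @ drop (Suc k) ls) ! p m = ls ! m \<and> p m < length (take k ls @ drop (Suc k) ls)"
      if "m < length ls" "m \<noteq> k" for m
      using that k by (auto simp: p_def nth_append min_def)
    have "ls ! i = x" "ls ! j = x"
      by (auto simp: ls i_def j_def nth_append)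
    moreover have "p i \<noteq> p j"
      using ij k by (auto simp: p_def)
    ultimately have "\<not> distinct (take k ls @ drop (Suc k) ls)"
      using p[OF ij(1)] p[OF ij(2)] k nth_eq_iff_index_eq[of "take k ls @ drop (Suc k) ls" "p i" "p j"]
      by auto
    then show ?thesis unfolding h_def tensor_wedge_def by (simp only: if_False)
  qed
  have nth: "ls ! i = x" "ls ! j = x"
    by (auto simp: ls i_def j_def nth_append)
  have ri: "take i ls @ drop (Suc i) ls = (xs @ ys) @ x # zs"
    and rj: "take j ls @ drop (Suc j) ls = xs @ x # (ys @ zs)"
    by (simp_all add: ls i_def j_def)
  have "h i + h j = 0"
  proof (cases "distinct (xs @ x # (ys @ zs))")
    case True
    have inj: "inj_on num (set (xs @ x # (ys @ zs)))" "inj_on num (set ((xs @ ys) @ x # zs))"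
      using num by (auto simp: ls inj_on_def)
    have d: "distinct ((xs @ ys) @ x # zs)" using True by auto
    define u v where "u = (wedge_sign num ((xs @ ys) @ x # zs) :: 'a)"
      and "v = (wedge_sign num (xs @ x # (ys @ zs)) :: 'a)"
    have uv: "u * (- 1) ^ Suc i = - (v * (- 1) ^ Suc j)"
      unfolding u_def v_def wedge_sign_move[OF True inj(1)] wedge_sign_move[OF d inj(2)]
      by (simp add: i_def j_def power_add mult.assoc mult.left_commute mult.commute)
    have set: "set ((xs @ ys) @ x # zs) = set (xs @ x # (ys @ zs))" by auto
    have hi: "h i = Poly_Mapping.single (set (xs @ x # (ys @ zs)))
        (dscale scale (u * (- 1) ^ Suc i) (g x))"
      unfolding h_def tensor_wedge_def ri nth if_P[OF d] set dscale_dscale u_def ..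
    have hj: "h j = Poly_Mapping.single (set (xs @ x # (ys @ zs)))
        (dscale scale (v * (- 1) ^ Suc j) (g x))"
      unfolding h_def tensor_wedge_def rj nth if_P[OF True] dscale_dscale v_def ..
    show ?thesis
      unfolding hi hj uv dscale_uminus single_uminus by simp
  next
    case False
    then have "\<not> distinct ((xs @ ys) @ x # zs)" by auto
    then show ?thesis
      unfolding h_def tensor_wedge_def ri rj using False by (simp only: if_False) simp
  qed
  moreover have "(\<Sum>k<length ls. h k) = (\<Sum>k\<in>{i, j}. h k)"
    by (rule sum.mono_neutral_right) (use ij zero in auto)
  ultimately have "(\<Sum>k<length ls. h k) = 0"
    using ij by simp
  then show ?thesis
    using False by (simp add: koszul_d_def tensor_wedge_def h_def g_def)
qed

end

definition cscale :: "('r \<Rightarrow> 'b::zero \<Rightarrow> 'b) \<Rightarrow> 'r \<Rightarrow> ('a, 'b) chain \<Rightarrow> ('a, 'b) chain" where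
  "cscale smul r = Poly_Mapping.map (dscale smul r)"

text \<open>
  \<open>summands F S j\<close> is the direct sum of all \<open>F z \<otimes> e\<^sub>Q\<close> with \<open>(z, Q) \<in> S\<close> and \<open>card Q = j\<close>.
\<close>

definition summands ::
    "('a \<Rightarrow> 'b::zero set) \<Rightarrow> ('a \<times> 'a set) set \<Rightarrow> nat \<Rightarrow> ('a, 'b) chain set" where
  "summands F S j = {c. \<forall>Q\<in>Poly_Mapping.keys c. card Q = j \<and>
     (\<forall>z\<in>Poly_Mapping.keys (Poly_Mapping.lookup c Q).
        (z, Q) \<in> S \<and> Poly_Mapping.lookup (Poly_Mapping.lookup c Q) z \<in> F z)}"

definition koszul :: "'a::real_inner set \<Rightarrow> 'a set \<Rightarrow> ('a \<Rightarrow> 'b::zero set) \<Rightarrow>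
    nat \<Rightarrow> ('a, 'b) chain set" where
  "koszul Phi Delta F = summands F (pairs Phi Delta)"

definition koszul_le :: "'a::real_inner set \<Rightarrow> 'a set \<Rightarrow> 'a \<Rightarrow> ('a \<Rightarrow> 'b::zero set) \<Rightarrow>
    real \<Rightarrow> nat \<Rightarrow> ('a, 'b) chain set" where
  "koszul_le Phi Delta z0 F eps =
     summands F {(z, Q) \<in> pairs Phi Delta. eps_of Phi z0 z Q \<le> eps}"

definition koszul_less :: "'a::real_inner set \<Rightarrow> 'a set \<Rightarrow> 'a \<Rightarrow> ('a \<Rightarrow> 'b::zero set) \<Rightarrow>
    real \<Rightarrow> nat \<Rightarrow> ('a, 'b) chain set" where
  "koszul_less Phi Delta z0 F eps =
     summands F {(z, Q) \<in> pairs Phi Delta. eps_of Phi z0 z Q < eps}"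

definition chain_proj :: "('a \<times> 'a set) set \<Rightarrow> ('a, 'b::zero) chain \<Rightarrow> ('a, 'b) chain" where
  "chain_proj S =
     Poly_Mapping.mapp (\<lambda>Q. Poly_Mapping.mapp (\<lambda>z v. if (z, Q) \<in> S then v else 0))"

definition subcomplex :: "('r::comm_ring_1 \<Rightarrow> 'c::ab_group_add \<Rightarrow> 'c) \<Rightarrow> ('c \<Rightarrow> 'c) \<Rightarrow>
    (nat \<Rightarrow> 'c set) \<Rightarrow> (nat \<Rightarrow> 'c set) \<Rightarrow> bool" where
  "subcomplex smul d C S \<longleftrightarrow>
     (\<forall>j. S j \<subseteq> C j \<and> module.subspace smul (S j)) \<and> (\<forall>j. d ` S (Suc j) \<subseteq> S j)"

text \<open>
  The quotient of a submodule \<open>M\<close> by a submodule \<open>N\<close> consists of the cosets \<open>c +o N\<close>, which are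
  added as sets.  A homomorphism \<open>h\<close> that maps \<open>N\<close> into \<open>N'\<close> induces \<open>coset_map h N'\<close> on cosets:
  it sends \<open>c +o N\<close> to \<open>h c +o N'\<close>.
\<close>

definition quotient :: "'c::ab_group_add set \<Rightarrow> 'c set \<Rightarrow> 'c set set" where
  "quotient M N = (\<lambda>c. c +o N) ` M"

definition coset_map :: "('c \<Rightarrow> 'd::ab_group_add) \<Rightarrow> 'd set \<Rightarrow> 'c set \<Rightarrow> 'd set" where
  "coset_map h N' X = h ` X + N'"

definition koszul_quot :: "'a::real_inner set \<Rightarrow> 'a set \<Rightarrow> 'a \<Rightarrow> ('a \<Rightarrow> 'b::ab_group_add set) \<Rightarrow>
    real \<Rightarrow> nat \<Rightarrow> ('a, 'b) chain set set" where
  "koszul_quot Phi Delta z0 F eps j =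
     quotient (koszul_le Phi Delta z0 F eps j) (koszul_less Phi Delta z0 F eps j)"

text \<open>The differential from degree \<open>Suc j\<close> to degree \<open>j\<close> of the quotient complex:\<close>

definition koszul_quot_d :: "'a::real_inner set \<Rightarrow> 'a set \<Rightarrow> 'a \<Rightarrow> ('a \<Rightarrow> nat) \<Rightarrow>
    ('r::comm_ring_1 \<Rightarrow> 'b::ab_group_add \<Rightarrow> 'b) \<Rightarrow> ('a \<Rightarrow> 'b set) \<Rightarrow>
    ('a \<Rightarrow> ('a \<Rightarrow>\<^sub>0 'b) \<Rightarrow> ('a \<Rightarrow>\<^sub>0 'b)) \<Rightarrow> ('a \<Rightarrow> 'r) \<Rightarrow> real \<Rightarrow> nat \<Rightarrow>
    ('a, 'b) chain set \<Rightarrow> ('a, 'b) chain set" where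
  "koszul_quot_d Phi Delta z0 num smul F T alpha eps j =
     coset_map (koszul_d num smul T alpha) (koszul_less Phi Delta z0 F eps j)"

text \<open>
  The complex of submodules \<open>D j \<subseteq> M j\<close>, with differential \<open>dD\<close>, represents the quotient complex
  \<open>M / N\<close>, with the differential induced by \<open>d\<close>: the canonical map \<open>c \<mapsto> c +o N j\<close> is an isomorphism
  of complexes of modules.
\<close>

definition represents_quotient :: "('r::comm_ring_1 \<Rightarrow> 'c::ab_group_add \<Rightarrow> 'c) \<Rightarrow>
    (nat \<Rightarrow> 'c set) \<Rightarrow> ('c \<Rightarrow> 'c) \<Rightarrow> (nat \<Rightarrow> 'c set) \<Rightarrow> (nat \<Rightarrow> 'c set) \<Rightarrow> ('c \<Rightarrow> 'c) \<Rightarrow> bool" where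
  "represents_quotient smul D dD M N d \<longleftrightarrow>
     subcomplex smul dD M D \<and>
     (\<forall>j. bij_betw (\<lambda>c. c +o N j) (D j) (quotient (M j) (N j))) \<and>
     (\<forall>j. \<forall>c\<in>D j. \<forall>c'\<in>D j. (c + c') +o N j = (c +o N j) + (c' +o N j)) \<and>
     (\<forall>j r. \<forall>c\<in>D j. smul r c +o N j = coset_map (smul r) (N j) (c +o N j)) \<and>
     (\<forall>j. \<forall>c\<in>D (Suc j). dD c +o N j = coset_map d (N j) (c +o N (Suc j)))"

end

theory Submission
  imports Defs
begin

text \<open>
  Every vector is Weyl conjugate to a dominant one, and \<open>v x \<bullet> w y \<le> x \<bullet> y\<close> for dominant \<open>x\<close>, \<open>y\<close> and
  Weyl group elements \<open>v\<close>, \<open>w\<close>.  Hence if \<open>z0 - z = w c\<close> with \<open>c\<close> dominant, the maximum that defines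
  \<open>\<epsilon>(z, Q)\<close> is attained when every \<open>w\<^sub>\<lambda>\<close> is \<open>w\<close>, and it equals the norm of \<open>c + \<Sum>Q\<close>.  As dominant
  vectors have non-negative inner products, removing an element from \<open>Q\<close> strictly decreases \<open>\<epsilon>\<close>; this
  disposes of the terms with \<open>\<alpha>\<close>.  The points of \<open>calB l z\<close> are convex combinations of points \<open>z - w l\<close>,
  so by convexity of the norm \<open>T l\<close> does not leave the filtration step.  If \<open>\<epsilon>(z, Q) = \<epsilon>\<close>, genericity
  of \<open>z0\<close> forces \<open>z - \<Sum>w l = z_eps\<close>, and the equality case of the inequality shows that \<open>w\<close> agrees
  on \<open>Q\<close> with the Weyl group element chosen for \<open>z_eps\<close>.
\<close>

section \<open>Root reflections and simple roots\<close>

lemma root_reflection_linear: "linear (root_reflection a)"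
  by (rule linearI)
    (simp_all add: root_reflection_def inner_add_right scaleR_left_distrib scaleR_right_diff_distrib
      add_divide_distrib distrib_left)

lemma root_reflection_inner: "root_reflection a x \<bullet> root_reflection a y = x \<bullet> y"
  by (cases "a = 0")
    (simp_all add: root_reflection_def inner_diff_left inner_diff_right inner_commute divide_simps)

lemma root_reflection_self: "root_reflection a a = - a"
  by (cases "a = 0") (simp_all add: root_reflection_def algebra_simps flip: scaleR_2)

lemma root_reflection_involution [simp]: "root_reflection a (root_reflection a x) = x"
proof (cases "a = 0")
  case False
  have "a \<bullet> root_reflection a x = - (a \<bullet> x)"
    using False by (simp add: root_reflection_def inner_diff_right)
  then show ?thesis
    by (subst root_reflection_def) (simp add: root_reflection_def)
qed (simp add: root_reflection_def)

lemma root_reflection_uminus: "root_reflection (- a) = root_reflection a"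
  by (rule ext) (simp add: root_reflection_def)

lemma root_reflection_conj:
  assumes "linear w" "\<And>x y. w x \<bullet> w y = x \<bullet> y"
  shows "w (root_reflection a x) = root_reflection (w a) (w x)"
  using assms by (simp add: root_reflection_def linear_diff linear_cmul)

lemma orthogonal_to_spanning_eq_0:
  fixes v :: "'a::real_inner"
  assumes "span S = UNIV" "\<And>a. a \<in> S \<Longrightarrow> a \<bullet> v = 0"
  shows "v = 0"
proof -
  have "orthogonal v x" if "x \<in> span S" for x
    by (rule orthogonal_to_span[OF that]) (use assms(2) in \<open>auto simp: orthogonal_def inner_commute\<close>)
  then show ?thesis using assms(1) by (metis UNIV_I inner_eq_zero_iff orthogonal_def)
qed

text \<open>By independence the component of \<open>a\<close> orthogonal to the span of the other
  vectors is non-zero; a suitable multiple of it pairs to 1 with \<open>a\<close>.\<close>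

lemma exists_dual_vector:
  fixes S :: "'a::real_inner set"
  assumes "finite S" "independent S" "a \<in> S"
  shows "\<exists>l. a \<bullet> l = 1 \<and> (\<forall>b\<in>S - {a}. b \<bullet> l = 0)"
proof -
  obtain C where C: "finite C" "span C = span (S - {a})" "pairwise orthogonal C"
    using basis_orthogonal[of "S - {a}"] assms(1) by auto
  \<comment> \<open>\<open>p\<close> is the orthogonal projection of \<open>a\<close> to the span of
    \<open>C\<close>. A zero vector in \<open>C\<close> does no harm, because division by zero gives
    0.\<close>
  define p where "p = (\<Sum>b\<in>C. (b \<bullet> a / (b \<bullet> b)) *\<^sub>R b)"
  define v where "v = a - p"
  have p: "p \<in> span C"
    by (auto simp: p_def intro: span_sum span_scale span_base)
  have "c \<bullet> v = 0" if "c \<in> C" for c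
  proof -
    have "b \<bullet> a / (b \<bullet> b) * (c \<bullet> b) = (if b = c then c \<bullet> a else 0)" if "b \<in> C" for b
      using C(3) \<open>c \<in> C\<close> that by (auto simp: pairwise_def orthogonal_def)
    then have "c \<bullet> p = (\<Sum>b\<in>C. if b = c then c \<bullet> a else 0)"
      unfolding p_def inner_sum_right inner_scaleR_right by (intro sum.cong) auto
    then show ?thesis
      using C(1) that by (simp add: v_def inner_diff_right)
  qed
  then have "orthogonal v x" if "x \<in> span C" for x
    by (intro orthogonal_to_span[OF that]) (simp add: orthogonal_def inner_commute)
  then have orth: "x \<bullet> v = 0" if "x \<in> span C" for x
    using that by (metis inner_commute orthogonal_def)
  have "v \<noteq> 0"
    using assms(2,3) p C(2) unfolding dependent_def v_def by auto
  moreover have "a \<bullet> v = v \<bullet> v"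
    using orth[OF p] by (simp add: v_def inner_diff_left)
  ultimately have "a \<bullet> ((1 / (v \<bullet> v)) *\<^sub>R v) = 1" by simp
  moreover have "b \<bullet> ((1 / (v \<bullet> v)) *\<^sub>R v) = 0" if "b \<in> S - {a}" for b
    using orth[of b] that C(2) by (simp add: span_base)
  ultimately show ?thesis by blast
qed

section \<open>Simple roots, fundamental coweights and the dominant cone\<close>

locale based_root_system = root_system Phi
  for Phi :: "'a::real_inner set" +
  fixes Delta :: "'a set"
  assumes base: "root_base Phi Delta"
begin

lemma Delta_subset: "Delta \<subseteq> Phi" and Delta_independent: "independent Delta"
  using base by (auto simp: root_base_def)

lemma finite_Delta: "finite Delta"
  using Delta_subset finite_roots finite_subset by blast

lemma span_Delta: "span Delta = UNIV"
proof -
  have "b \<in> span Delta" if "b \<in> Phi" for b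
    using base that unfolding root_base_def
    by (metis (no_types, lifting) span_base span_neg span_scale span_sum)
  then have "span Phi \<subseteq> span Delta"
    by (intro span_minimal) auto
  then show ?thesis using span_roots by auto
qed

lemma eq_if_inner_Delta_eq: "(\<And>a. a \<in> Delta \<Longrightarrow> a \<bullet> x = a \<bullet> y) \<Longrightarrow> x = y"
  using orthogonal_to_spanning_eq_0[OF span_Delta, of "x - y"] by (simp add: inner_diff_right)

text \<open>\<open>nabla\<close> is only a set of vectors; the expansions below need the fundamental
  coweights indexed by the simple roots to which they are dual.\<close>

definition fundamental :: "'a \<Rightarrow> 'a" where
  "fundamental a = (SOME l. a \<bullet> l = 1 \<and> (\<forall>b\<in>Delta - {a}. b \<bullet> l = 0))"

lemma inner_fundamental:
  assumes "a \<in> Delta" "b \<in> Delta"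
  shows "b \<bullet> fundamental a = (if b = a then 1 else 0)"
  using someI_ex[OF exists_dual_vector[OF finite_Delta Delta_independent assms(1)]] assms(2)
  by (auto simp: fundamental_def)

lemma inj_on_fundamental: "inj_on fundamental Delta"
  using inner_fundamental by (metis inj_onI zero_neq_one)

lemma nabla_eq: "nabla Delta = fundamental ` Delta"
proof
  show "fundamental ` Delta \<subseteq> nabla Delta"
    using inner_fundamental by (auto simp: nabla_def)
  show "nabla Delta \<subseteq> fundamental ` Delta"
  proof
    fix l assume "l \<in> nabla Delta"
    then obtain a where "a \<in> Delta" "a \<bullet> l = 1" "\<forall>b\<in>Delta - {a}. b \<bullet> l = 0"
      by (auto simp: nabla_def)
    then have "l = fundamental a"
      by (intro eq_if_inner_Delta_eq) (auto simp: inner_fundamental)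
    then show "l \<in> fundamental ` Delta" using \<open>a \<in> Delta\<close> by blast
  qed
qed

lemma finite_nabla: "finite (nabla Delta)"
  by (simp add: nabla_eq finite_Delta)

lemma fundamental_expansion: "v = (\<Sum>a\<in>Delta. (a \<bullet> v) *\<^sub>R fundamental a)"
  by (rule eq_if_inner_Delta_eq)
    (simp add: inner_sum_right inner_fundamental finite_Delta if_distrib cong: if_cong)

lemma simple_root_expansion: "v = (\<Sum>a\<in>Delta. (fundamental a \<bullet> v) *\<^sub>R a)"
proof -
  have "v \<bullet> x = (\<Sum>a\<in>Delta. (fundamental a \<bullet> v) *\<^sub>R a) \<bullet> x" for x
  proof -
    have "v \<bullet> x = v \<bullet> (\<Sum>a\<in>Delta. (a \<bullet> x) *\<^sub>R fundamental a)"
      using fundamental_expansion[of x] by simp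
    then show ?thesis
      by (simp add: inner_sum_right inner_sum_left inner_commute mult.commute)
  qed
  then show ?thesis by (metis inner_commute vector_eq_ldot)
qed

definition dominant :: "'a \<Rightarrow> bool" where
  "dominant v \<longleftrightarrow> (\<forall>a\<in>Delta. 0 \<le> a \<bullet> v)"

lemma closed_cone_eq: "closed_cone Delta = Collect dominant"
proof
  show "closed_cone Delta \<subseteq> Collect dominant"
    by (auto simp: closed_cone_def dominant_def nabla_eq inner_sum_right inner_fundamental
        intro!: sum_nonneg mult_nonneg_nonneg)
  show "Collect dominant \<subseteq> closed_cone Delta"
  proof
    fix v assume v: "v \<in> Collect dominant"
    \<comment> \<open>The coefficients in \<open>closed_cone\<close> are indexed by coweights, so
      the simple root has to be recovered from its coweight.\<close>
    define r where "r l = inv_into Delta fundamental l \<bullet> v" for l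
    have r: "r (fundamental a) = a \<bullet> v" if "a \<in> Delta" for a
      using that by (simp add: r_def inv_into_f_f inj_on_fundamental)
    have "v = (\<Sum>l\<in>nabla Delta. r l *\<^sub>R l)"
      by (subst fundamental_expansion)
        (simp add: nabla_eq sum.reindex[OF inj_on_fundamental] r cong: sum.cong)
    moreover have "\<forall>l\<in>nabla Delta. 0 \<le> r l"
      using v r by (auto simp: nabla_eq dominant_def)
    ultimately show "v \<in> closed_cone Delta"
      unfolding closed_cone_def by blast
  qed
qed

lemma dominant_add: "dominant x \<Longrightarrow> dominant y \<Longrightarrow> dominant (x + y)"
  by (simp add: dominant_def inner_add_right)

lemma dominant_sum: "(\<And>i. i \<in> I \<Longrightarrow> dominant (f i)) \<Longrightarrow> dominant (sum f I)"
  by (simp add: dominant_def inner_sum_right sum_nonneg)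

lemma dominant_nabla: "l \<in> nabla Delta \<Longrightarrow> dominant l"
  by (auto simp: nabla_eq dominant_def inner_fundamental)

text \<open>By \<open>simple_root_expansion\<close>, \<open>fundamental a \<bullet> b\<close> is the
  coefficient of \<open>b\<close> at the simple root \<open>a\<close>.\<close>

definition positive_root :: "'a \<Rightarrow> bool" where
  "positive_root b \<longleftrightarrow> b \<in> Phi \<and> (\<forall>a\<in>Delta. 0 \<le> fundamental a \<bullet> b)"

lemma root_coefficient_nat:
  assumes "b \<in> Phi"
  obtains n :: "'a \<Rightarrow> nat" where
    "(\<forall>a\<in>Delta. fundamental a \<bullet> b = real (n a)) \<or> (\<forall>a\<in>Delta. fundamental a \<bullet> b = - real (n a))"
proof -
  obtain n :: "'a \<Rightarrow> nat" where n: "b = (\<Sum>a\<in>Delta. real (n a) *\<^sub>R a) \<or>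
      b = - (\<Sum>a\<in>Delta. real (n a) *\<^sub>R a)"
    using base assms unfolding root_base_def by blast
  have "fundamental a \<bullet> (\<Sum>a\<in>Delta. real (n a) *\<^sub>R a) = real (n a)" if "a \<in> Delta" for a
  proof -
    have "fundamental a \<bullet> (\<Sum>a\<in>Delta. real (n a) *\<^sub>R a) =
        (\<Sum>c\<in>Delta. real (n c) * (c \<bullet> fundamental a))"
      by (simp add: inner_sum_right inner_commute)
    then show ?thesis
      using that by (simp add: inner_fundamental finite_Delta if_distrib cong: if_cong)
  qed
  then show ?thesis using n that[of n] by auto
qed

lemma uminus_root: "b \<in> Phi \<Longrightarrow> - b \<in> Phi"
  using reflection_root[of b b] by (simp add: root_reflection_self)

lemma positive_or_negative: "b \<in> Phi \<Longrightarrow> positive_root b \<or> positive_root (- b)"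
  by (rule root_coefficient_nat[of b]) (auto simp: positive_root_def uminus_root)

lemma positive_simple: "a \<in> Delta \<Longrightarrow> positive_root a"
  using Delta_subset inner_fundamental
  by (auto simp: positive_root_def inner_commute)

text \<open>Reflection in \<open>a\<close> changes only the coefficient at \<open>a\<close>. If the
  image were negative, all other coefficients of \<open>b\<close> would vanish, and
  \<open>b\<close>, a positive multiple of \<open>a\<close>, would equal \<open>a\<close> since the
  root system is reduced.\<close>

lemma simple_reflection_positive:
  assumes a: "a \<in> Delta" and b: "positive_root b" and "b \<noteq> a"
  shows "positive_root (root_reflection a b)"
proof (rule ccontr)
  assume "\<not> ?thesis"
  moreover have "root_reflection a b \<in> Phi"
    using a b Delta_subset reflection_root by (auto simp: positive_root_def)
  ultimately have neg: "positive_root (- root_reflection a b)"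
    using positive_or_negative by blast
  have "fundamental c \<bullet> b = 0" if "c \<in> Delta" "c \<noteq> a" for c
  proof -
    have "fundamental c \<bullet> a = 0" using inner_fundamental[of c a] a that by (simp add: inner_commute)
    then have "fundamental c \<bullet> root_reflection a b = fundamental c \<bullet> b"
      by (simp add: root_reflection_def inner_diff_right)
    then show ?thesis using neg b that by (force simp: positive_root_def)
  qed
  then have "b = (\<Sum>c\<in>Delta. if c = a then (fundamental a \<bullet> b) *\<^sub>R a else 0)"
    by (subst simple_root_expansion) (auto intro!: sum.cong)
  then have eq: "b = (fundamental a \<bullet> b) *\<^sub>R a"
    using a finite_Delta by simp
  then have "fundamental a \<bullet> b = 1 \<or> fundamental a \<bullet> b = - 1"
    using reduced[of a "fundamental a \<bullet> b"] a b Delta_subset by (auto simp: positive_root_def)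
  moreover have "0 \<le> fundamental a \<bullet> b"
    using a b by (simp add: positive_root_def)
  ultimately show False
    using eq \<open>b \<noteq> a\<close> by auto
qed

end

section \<open>The Weyl group\<close>

lemma weyl_linear: "w \<in> weyl Phi \<Longrightarrow> linear w"
  by (induction rule: weyl.induct) (blast intro: linear_compose root_reflection_linear linear_id)+

lemma weyl_inner: "w \<in> weyl Phi \<Longrightarrow> w x \<bullet> w y = x \<bullet> y"
  by (induction rule: weyl.induct) (simp_all add: root_reflection_inner)

lemma weyl_norm: "w \<in> weyl Phi \<Longrightarrow> norm (w x) = norm x"
  by (simp add: norm_eq_sqrt_inner weyl_inner)

lemma weyl_comp: "v \<in> weyl Phi \<Longrightarrow> w \<in> weyl Phi \<Longrightarrow> v \<circ> w \<in> weyl Phi"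
  by (induction rule: weyl.induct) (auto simp: comp_assoc intro: weyl.intros)

lemma weyl_reflection: "a \<in> Phi \<Longrightarrow> root_reflection a \<in> weyl Phi"
  using weyl.intros(2)[OF _ weyl.intros(1)] by force

lemma weyl_inverse:
  assumes "w \<in> weyl Phi"
  obtains v where "v \<in> weyl Phi" "\<And>x. v (w x) = x" "\<And>x. w (v x) = x"
proof -
  have "\<exists>v\<in>weyl Phi. (\<forall>x. v (w x) = x) \<and> (\<forall>x. w (v x) = x)"
    using assms
  proof (induction rule: weyl.induct)
    case 1
    show ?case by (intro bexI[of _ id]) (auto intro: weyl.intros)
  next
    case (2 a w)
    then obtain v where v: "v \<in> weyl Phi" "\<forall>x. v (w x) = x" "\<forall>x. w (v x) = x" by blast
    then show ?case
      using 2(1) by (intro bexI[of _ "v \<circ> root_reflection a"]) (auto intro: weyl_comp weyl_reflection)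
  qed
  then show ?thesis using that by blast
qed

lemma (in root_system) weyl_root: "w \<in> weyl Phi \<Longrightarrow> b \<in> Phi \<Longrightarrow> w b \<in> Phi"
  by (induction rule: weyl.induct) (auto intro: reflection_root)

text \<open>Weyl group elements map the finite set of roots to itself and, being linear, are
  determined by their restriction to this spanning set.\<close>

lemma (in root_system) finite_weyl: "finite (weyl Phi)"
proof (rule inj_on_finite)
  show "finite (Phi \<rightarrow>\<^sub>E Phi)"
    using finite_roots by (simp add: finite_PiE)
  show "(\<lambda>w. restrict w Phi) ` weyl Phi \<subseteq> Phi \<rightarrow>\<^sub>E Phi"
    by (auto simp: weyl_root)
  show "inj_on (\<lambda>w. restrict w Phi) (weyl Phi)"
  proof (rule inj_onI)
    fix v w assume *: "v \<in> weyl Phi" "w \<in> weyl Phi" "restrict v Phi = restrict w Phi"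
    have "v x = w x" if "x \<in> Phi" for x
      using *(3) that by (metis restrict_apply')
    then have "v x = w x" for x
      using linear_eq_on_span[OF weyl_linear[OF *(1)] weyl_linear[OF *(2)], of Phi x] span_roots
      by auto
    then show "v = w" by blast
  qed
qed

lemma (in root_system) weyl_coweight_lattice:
  assumes "w \<in> weyl Phi" "x \<in> coweight_lattice Phi"
  shows "w x \<in> coweight_lattice Phi"
proof -
  obtain v where v: "v \<in> weyl Phi" "\<And>x. w (v x) = x" using weyl_inverse[OF assms(1)] by metis
  have "b \<bullet> w x \<in> \<int>" if "b \<in> Phi" for b
    using weyl_inner[OF assms(1), of "v b" x] weyl_root[OF v(1) that] assms(2) v(2)
    by (auto simp: coweight_lattice_def)
  then show ?thesis by (simp add: coweight_lattice_def)
qed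

lemma coweight_lattice_add:
  "x \<in> coweight_lattice Phi \<Longrightarrow> y \<in> coweight_lattice Phi \<Longrightarrow> x + y \<in> coweight_lattice Phi"
  by (simp add: coweight_lattice_def inner_add_right)

lemma coweight_lattice_diff:
  "x \<in> coweight_lattice Phi \<Longrightarrow> y \<in> coweight_lattice Phi \<Longrightarrow> x - y \<in> coweight_lattice Phi"
  by (simp add: coweight_lattice_def inner_diff_right)

lemma coweight_lattice_sum:
  "(\<And>i. i \<in> I \<Longrightarrow> f i \<in> coweight_lattice Phi) \<Longrightarrow> sum f I \<in> coweight_lattice Phi"
  by (auto simp: coweight_lattice_def inner_sum_right intro!: Ints_sum)

context based_root_system
begin

lemma nabla_coweight_lattice: "l \<in> nabla Delta \<Longrightarrow> l \<in> coweight_lattice Phi"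
proof -
  assume "l \<in> nabla Delta"
  then obtain a where l: "a \<in> Delta" "l = fundamental a" by (auto simp: nabla_eq)
  have "b \<bullet> fundamental a \<in> \<int>" if "b \<in> Phi" for b
    by (rule root_coefficient_nat[OF that]) (use l in \<open>auto simp: inner_commute[of b]\<close>)
  then show ?thesis by (simp add: l coweight_lattice_def)
qed

section \<open>Words in simple reflections, the exchange property and extremality of dominant
  vectors\<close>

abbreviation simple_word :: "'a list \<Rightarrow> 'a \<Rightarrow> 'a" where
  "simple_word \<equiv> foldr root_reflection"

lemma simple_word_weyl: "set as \<subseteq> Delta \<Longrightarrow> simple_word as \<in> weyl Phi"
  using Delta_subset by (induction as) (auto intro: weyl.intros)

text \<open>Induction on the height, that is, the sum of the simple root coefficients: a positive
  root that is not simple is made lower by some simple reflection and stays positive.\<close>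

lemma positive_root_conj_simple:
  assumes "positive_root b"
  shows "\<exists>as a. set as \<subseteq> Delta \<and> a \<in> Delta \<and> b = simple_word as a"
proof -
  have "\<exists>n. (\<Sum>a\<in>Delta. fundamental a \<bullet> b) = real n" if pos: "positive_root b" for b
  proof -
    obtain n :: "'a \<Rightarrow> nat" where
      "(\<forall>a\<in>Delta. fundamental a \<bullet> b = real (n a)) \<or> (\<forall>a\<in>Delta. fundamental a \<bullet> b = - real (n a))"
      using pos root_coefficient_nat[of b] unfolding positive_root_def by blast
    then have "\<forall>a\<in>Delta. fundamental a \<bullet> b = real (n a)"
      using pos by (force simp: positive_root_def)
    then have "(\<Sum>a\<in>Delta. fundamental a \<bullet> b) = real (\<Sum>a\<in>Delta. n a)" by simp
    then show ?thesis by blast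
  qed
  then obtain n where "(\<Sum>a\<in>Delta. fundamental a \<bullet> b) = real n" using assms by blast
  then show ?thesis using assms
  proof (induction n arbitrary: b rule: less_induct)
    case (less n)
    show ?case
    proof (cases "b \<in> Delta")
      case True
      then show ?thesis by (intro exI[of _ "[]"] exI[of _ b]) auto
    next
      case False
      have "b \<noteq> 0" using less.prems zero_not_root by (auto simp: positive_root_def)
      \<comment> \<open>Otherwise expanding one factor of \<open>b \<bullet> b\<close> in simple
        roots would give a non-positive value.\<close>
      have "\<exists>a\<in>Delta. 0 < a \<bullet> b"
      proof (rule ccontr)
        assume "\<not> ?thesis"
        then have "(\<Sum>a\<in>Delta. (fundamental a \<bullet> b) * (a \<bullet> b)) \<le> 0"
          using less.prems by (intro sum_nonpos mult_nonneg_nonpos) (auto simp: positive_root_def not_less)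
        moreover have "b \<bullet> b = (\<Sum>a\<in>Delta. (fundamental a \<bullet> b) * (a \<bullet> b))"
          by (subst (1) simple_root_expansion[of b]) (simp add: inner_sum_left)
        ultimately show False using \<open>b \<noteq> 0\<close> by (metis inner_gt_zero_iff not_less)
      qed
      then obtain a where a: "a \<in> Delta" "0 < a \<bullet> b" by blast
      define c where "c = root_reflection a b"
      have c: "positive_root c"
        unfolding c_def using less.prems a False by (intro simple_reflection_positive) auto
      then obtain m where m: "(\<Sum>a\<in>Delta. fundamental a \<bullet> c) = real m"
        using \<open>\<And>b. positive_root b \<Longrightarrow> \<exists>n. (\<Sum>a\<in>Delta. fundamental a \<bullet> b) = real n\<close> by blast
      \<comment> \<open>A simple root has height 1, so the reflection lowers the height of
        \<open>b\<close> by \<open>2 * (a \<bullet> b) / (a \<bullet> a)\<close>.\<close>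
      have ht: "(\<Sum>c\<in>Delta. fundamental c \<bullet> a) = 1"
        using a(1) finite_Delta by (simp add: inner_commute[of _ a] inner_fundamental cong: sum.cong)
      have "a \<noteq> 0" using a by auto
      have "real m = real n - 2 * (a \<bullet> b) / (a \<bullet> a) * (\<Sum>c\<in>Delta. fundamental c \<bullet> a)"
        unfolding less.prems(1)[symmetric] m[symmetric] c_def root_reflection_def
        by (simp add: inner_diff_right sum_subtractf sum_distrib_left)
      moreover have "0 < 2 * (a \<bullet> b) / (a \<bullet> a)"
        using a \<open>a \<noteq> 0\<close> by simp
      ultimately have "m < n"
        using ht by simp
      then obtain as a' where as: "set as \<subseteq> Delta" "a' \<in> Delta" "c = simple_word as a'"
        using less.IH[OF _ m c] by blast
      then have "b = simple_word (a # as) a'"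
        by (simp flip: as(3)) (simp add: c_def)
      then show ?thesis using as a by (intro exI[of _ "a # as"] exI[of _ a']) auto
    qed
  qed
qed

text \<open>The reflection in \<open>w a\<close> is the conjugate by \<open>w\<close> of the
  reflection in \<open>a\<close>, and the inverse of a word is the reversed word.\<close>

lemma simple_word_conj:
  assumes "set as \<subseteq> Delta"
  shows "root_reflection (simple_word as a) = simple_word (as @ a # rev as)"
proof
  fix x
  have inv: "simple_word as (simple_word (rev as) x) = x" for x
    by (induction as arbitrary: x) auto
  show "root_reflection (simple_word as a) x = simple_word (as @ a # rev as) x"
    using root_reflection_conj[OF weyl_linear weyl_inner, OF simple_word_weyl simple_word_weyl,
        OF assms assms, of a "simple_word (rev as) x"]
    by (simp add: inv)
qed

text \<open>Each root reflection is the reflection in a positive root, hence a conjugate of a simple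
  reflection by a word.\<close>

lemma weyl_simple_word:
  assumes "w \<in> weyl Phi"
  shows "\<exists>as. set as \<subseteq> Delta \<and> w = simple_word as"
  using assms
proof (induction rule: weyl.induct)
  case 1
  then show ?case by (intro exI[of _ "[]"]) (auto simp: id_def)
next
  case (2 b w)
  obtain as where as: "set as \<subseteq> Delta" "w = simple_word as" using 2 by blast
  obtain bs where bs: "set bs \<subseteq> Delta" "root_reflection b = simple_word bs"
  proof -
    obtain c where c: "positive_root c" "root_reflection b = root_reflection c"
      using positive_or_negative[OF 2(1)] root_reflection_uminus by metis
    obtain cs a where cs: "set cs \<subseteq> Delta" "a \<in> Delta" "c = simple_word cs a"
      using positive_root_conj_simple[OF c(1)] by blast
    have "root_reflection b = simple_word (cs @ a # rev cs)"
      unfolding c(2) cs(3) by (rule simple_word_conj[OF cs(1)])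
    then show ?thesis
      using cs by (intro that[of "cs @ a # rev cs"]) auto
  qed
  show ?case
    using as bs by (intro exI[of _ "bs @ as"]) auto
qed

text \<open>Apply the letters of \<open>as\<close> to \<open>a\<close> one by one, from the right.
  At some letter \<open>b\<close> the root ceases to be positive; just before, it must be
  \<open>b\<close> itself by \<open>simple_reflection_positive\<close>, and then conjugation cancels
  \<open>b\<close> against the final \<open>a\<close>.\<close>

lemma simple_word_exchange:
  assumes "set as \<subseteq> Delta" "a \<in> Delta" "\<not> positive_root (simple_word as a)"
  shows "\<exists>bs. set bs \<subseteq> Delta \<and> length bs < length as \<and> simple_word (as @ [a]) = simple_word bs"
  using assms
proof (induction as)
  case Nil
  then show ?case using positive_simple by simp
next
  case (Cons b as)
  show ?case
  proof (cases "positive_root (simple_word as a)")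
    case True
    then have eq: "simple_word as a = b"
      using Cons.prems simple_reflection_positive[of b "simple_word as a"] by auto
    have as: "set as \<subseteq> Delta" using Cons.prems by simp
    have "simple_word ((b # as) @ [a]) x = simple_word as x" for x
      using root_reflection_conj[OF weyl_linear weyl_inner, OF simple_word_weyl simple_word_weyl,
        OF as as, of a x] eq by simp
    then show ?thesis using Cons.prems by (intro exI[of _ as]) auto
  next
    case False
    moreover have "set as \<subseteq> Delta" using Cons.prems by simp
    ultimately obtain bs where "set bs \<subseteq> Delta" "length bs < length as"
        "simple_word (as @ [a]) = simple_word bs"
      using Cons.IH Cons.prems(2) by blast
    then show ?thesis
      using Cons.prems by (intro exI[of _ "b # bs"]) auto
  qed
qed

text \<open>Induction on the length of a word for \<open>w\<close>. If the word is \<open>u\<close>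
  followed by the letter \<open>b\<close>, then \<open>w x\<close> is \<open>u x\<close> minus a
  non-negative multiple of \<open>u b\<close>; either \<open>u b\<close> is positive and the
  subtraction can only lower the value, or the exchange property gives a shorter word.\<close>

lemma dominant_inner_fundamental_max:
  assumes "w \<in> weyl Phi" "dominant x" "a \<in> Delta"
  shows "fundamental a \<bullet> w x \<le> fundamental a \<bullet> x"
proof -
  obtain as where "set as \<subseteq> Delta" "w = simple_word as"
    using weyl_simple_word[OF assms(1)] by blast
  then show ?thesis
  proof (induction "length as" arbitrary: as w rule: less_induct)
    case less
    show ?case
    proof (cases as rule: rev_cases)
      case Nil
      then show ?thesis using less by simp
    next
      case (snoc bs b)
      have bs: "set bs \<subseteq> Delta" and b: "b \<in> Delta" using less snoc by auto
      show ?thesis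
      proof (cases "positive_root (simple_word bs b)")
        case True
        have "w x = simple_word bs x - (2 * (b \<bullet> x) / (b \<bullet> b)) *\<^sub>R simple_word bs b"
          using weyl_linear[OF simple_word_weyl[OF bs]] less.prems(2) snoc
          by (simp add: root_reflection_def linear_diff linear_cmul)
        moreover have "0 \<le> 2 * (b \<bullet> x) / (b \<bullet> b) * (fundamental a \<bullet> simple_word bs b)"
          using True assms(2,3) b by (auto simp: positive_root_def dominant_def)
        moreover have "fundamental a \<bullet> simple_word bs x \<le> fundamental a \<bullet> x"
          using less.hyps[of bs] bs snoc by simp
        ultimately show ?thesis by (simp add: inner_diff_right)
      next
        case False
        then obtain cs where "set cs \<subseteq> Delta" "length cs < length bs" "w = simple_word cs"
          using simple_word_exchange[OF bs b] less.prems(2) snoc by metis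
        then show ?thesis using less.hyps[of cs] snoc by simp
      qed
    qed
  qed
qed

text \<open>Moving \<open>w\<close> to the other side leaves a single group element acting on
  \<open>x\<close>. As \<open>y\<close> is a non-negative combination of fundamental coweights,
  \<open>dominant_inner_fundamental_max\<close> applies term by term.\<close>

lemma dominant_inner_weyl_le:
  assumes "v \<in> weyl Phi" "w \<in> weyl Phi" "dominant x" "dominant y"
  shows "v x \<bullet> w y \<le> x \<bullet> y"
proof -
  obtain u where u: "u \<in> weyl Phi" "\<And>x. w (u x) = x" using weyl_inverse[OF assms(2)] by metis
  have le: "(a \<bullet> y) * (fundamental a \<bullet> u (v x)) \<le> (a \<bullet> y) * (fundamental a \<bullet> x)" if "a \<in> Delta" for a
    using dominant_inner_fundamental_max[OF weyl_comp[OF u(1) assms(1)] assms(3) that] assms(4) that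
    by (auto simp: dominant_def intro: mult_left_mono)
  have exp: "z \<bullet> y = (\<Sum>a\<in>Delta. (a \<bullet> y) * (fundamental a \<bullet> z))" for z
    by (subst fundamental_expansion[of y]) (simp add: inner_sum_right inner_commute)
  have "v x \<bullet> w y = u (v x) \<bullet> y"
    using weyl_inner[OF assms(2), of "u (v x)" y] u(2) by simp
  also have "\<dots> \<le> x \<bullet> y"
    unfolding exp[of x] exp[of "u (v x)"] using le by (rule sum_mono)
  finally show ?thesis .
qed

text \<open>Take the point of the orbit that has the largest inner product with a vector
  \<open>u\<close> inside the cone: a simple root negative on that point would allow a reflection
  that increases this inner product.\<close>

lemma exists_dominant_conjugate: "\<exists>w\<in>weyl Phi. \<exists>c. dominant c \<and> v = w c"
proof -
  \<comment> \<open>The sum of all fundamental coweights pairs to 1 with every simple root, so the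
    change under a simple reflection can be read off.\<close>
  define u where "u = (\<Sum>a\<in>Delta. fundamental a)"
  have u: "a \<bullet> u = 1" if "a \<in> Delta" for a
    using that finite_Delta by (simp add: u_def inner_sum_right inner_fundamental)
  define m where "m = Max ((\<lambda>w. u \<bullet> w v) ` weyl Phi)"
  have fin: "finite ((\<lambda>w. u \<bullet> w v) ` weyl Phi)"
    using finite_weyl by (rule finite_imageI)
  moreover have "(\<lambda>w. u \<bullet> w v) ` weyl Phi \<noteq> {}"
    using weyl.intros(1) by blast
  ultimately have "m \<in> (\<lambda>w. u \<bullet> w v) ` weyl Phi"
    unfolding m_def by (rule Max_in)
  then obtain w where w: "w \<in> weyl Phi" and m: "m = u \<bullet> w v" by blast
  have max: "u \<bullet> w' v \<le> u \<bullet> w v" if "w' \<in> weyl Phi" for w'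
    unfolding m[symmetric] m_def by (rule Max_ge[OF fin]) (use that in blast)
  have "dominant (w v)"
    unfolding dominant_def
  proof
    fix a assume a: "a \<in> Delta"
    then have "a \<in> Phi" "a \<noteq> 0" using Delta_subset zero_not_root by auto
    have "u \<bullet> root_reflection a (w v) \<le> u \<bullet> w v"
      using max[OF weyl.intros(2)[OF \<open>a \<in> Phi\<close> w]] by simp
    then have "0 \<le> 2 * (a \<bullet> w v) / (a \<bullet> a) * (u \<bullet> a)"
      by (simp add: root_reflection_def inner_diff_right)
    then have "0 \<le> 2 * (a \<bullet> w v) / (a \<bullet> a)"
      using u[OF a] by (simp only: inner_commute[of u a] mult_1_right)
    moreover have "2 * (a \<bullet> w v) / (a \<bullet> a) < 0" if "a \<bullet> w v < 0"
      using that \<open>a \<noteq> 0\<close> by (intro divide_neg_pos) auto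
    ultimately show "0 \<le> a \<bullet> w v" by linarith
  qed
  moreover obtain w' where "w' \<in> weyl Phi" "\<And>x. w' (w x) = x" using weyl_inverse[OF w] by metis
  ultimately show ?thesis by metis
qed

text \<open>The orbit sum is fixed by every root reflection, hence orthogonal to all roots, and
  these span the space.\<close>

lemma sum_weyl_orbit_eq_0: "(\<Sum>w\<in>weyl Phi. w y) = 0"
proof (rule orthogonal_to_spanning_eq_0[OF span_roots])
  fix a assume a: "a \<in> Phi"
  define s where "s = (\<Sum>w\<in>weyl Phi. w y)"
  have "bij_betw (\<lambda>w. root_reflection a \<circ> w) (weyl Phi) (weyl Phi)"
    by (rule bij_betw_byWitness[of _ "\<lambda>w. root_reflection a \<circ> w"])
      (auto simp: fun_eq_iff intro: weyl.intros a)
  then have "(\<Sum>w\<in>weyl Phi. (root_reflection a \<circ> w) y) = s"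
    unfolding s_def by (rule sum.reindex_bij_betw)
  then have "root_reflection a s = s"
    unfolding s_def by (simp add: linear_sum[OF root_reflection_linear])
  moreover have "a \<noteq> 0" using a zero_not_root by auto
  ultimately show "a \<bullet> (\<Sum>w\<in>weyl Phi. w y) = 0"
    by (simp add: root_reflection_def s_def[symmetric])
qed

text \<open>Sum the inequality \<open>x \<bullet> w y \<le> x \<bullet> y\<close> over the Weyl
  group; the left side adds up to 0.\<close>

lemma dominant_inner_nonneg:
  assumes "dominant x" "dominant y"
  shows "0 \<le> x \<bullet> y"
proof -
  have "0 = (\<Sum>w\<in>weyl Phi. x \<bullet> w y)"
    by (simp add: sum_weyl_orbit_eq_0 flip: inner_sum_right)
  also have "\<dots> \<le> (\<Sum>w\<in>weyl Phi. x \<bullet> y)"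
    using dominant_inner_weyl_le[OF weyl.intros(1) _ assms] by (intro sum_mono) simp
  finally show ?thesis
    using finite_weyl weyl.intros(1)[of Phi] by (auto simp: zero_le_mult_iff card_eq_0_iff)
qed

end

section \<open>Walls and the filtration degree\<close>

lemma wall_reflection_hyperplane:
  assumes "b \<noteq> 0"
  shows "wall_reflection {x. b \<bullet> x = k} x = x - (2 * (b \<bullet> x - k) / (b \<bullet> b)) *\<^sub>R b"
proof -
  define p where "p = x - (2 * (b \<bullet> x - k) / (b \<bullet> b)) *\<^sub>R b"
  have bp: "b \<bullet> p = 2 * k - b \<bullet> x"
    using assms by (simp add: p_def inner_diff_right)
  have mid: "b \<bullet> midpoint x y = (b \<bullet> x + b \<bullet> y) / 2" for y
    by (simp add: midpoint_def inner_add_right)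
  have "wall_reflection {x. b \<bullet> x = k} x = p"
    unfolding wall_reflection_def
  proof (rule the_equality)
    show "midpoint x p \<in> {x. b \<bullet> x = k} \<and>
        (\<forall>q\<in>{x. b \<bullet> x = k}. \<forall>q'\<in>{x. b \<bullet> x = k}. (p - x) \<bullet> (q - q') = 0)"
      using mid[of p] bp by (simp add: p_def inner_diff_right)
  next
    fix y
    assume y: "midpoint x y \<in> {x. b \<bullet> x = k} \<and>
        (\<forall>q\<in>{x. b \<bullet> x = k}. \<forall>q'\<in>{x. b \<bullet> x = k}. (y - x) \<bullet> (q - q') = 0)"
    \<comment> \<open>Uniqueness: \<open>y - x\<close> and \<open>p - x\<close> are both orthogonal
      to the directions of the hyperplane, while the midpoint condition makes their difference
      \<open>d\<close> such a direction, so \<open>d\<close> is orthogonal to itself.\<close>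
    define d where "d = y - p"
    have bd: "b \<bullet> d = 0"
      using y mid[of y] bp by (simp add: d_def inner_diff_right)
    have m: "b \<bullet> midpoint x y = k" using y by simp
    then have "b \<bullet> (midpoint x y + d) = k" using bd by (simp add: inner_add_right)
    then have "(y - x) \<bullet> ((midpoint x y + d) - midpoint x y) = 0"
      using y m by blast
    moreover have "(p - x) \<bullet> d = 0"
      using bd by (simp add: p_def)
    moreover have "d = (y - x) - (p - x)" by (simp add: d_def)
    ultimately have "d \<bullet> d = 0"
      by (metis add_diff_cancel_left' diff_zero inner_diff_left)
    then show "y = p" by (simp add: d_def)
  qed
  then show ?thesis by (simp add: p_def)
qed

context based_root_system
begin

text \<open>The fundamental coweights other than the one dual to \<open>a\<close> span the kernel of
  \<open>a\<close>; moved by \<open>w\<close> and translated by \<open>t\<close>, this kernel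
  becomes the hyperplane through \<open>t\<close> with normal root \<open>w a\<close>.\<close>

lemma wall_hyperplane:
  assumes "H \<in> walls Phi Delta"
  obtains b k where "b \<in> Phi" "H = {x. b \<bullet> x = k}"
proof -
  obtain t w l where H: "H = (\<lambda>x. t + x) ` span (w ` (nabla Delta - {l}))"
    and w: "w \<in> weyl Phi" and l: "l \<in> nabla Delta"
    using assms by (auto simp: walls_def)
  obtain a where a: "a \<in> Delta" "l = fundamental a" using l by (auto simp: nabla_eq)
  obtain v where v: "v \<in> weyl Phi" "\<And>x. w (v x) = x" using weyl_inverse[OF w] by metis
  have "span (nabla Delta - {l}) = {x. a \<bullet> x = 0}"
  proof
    have "nabla Delta - {l} \<subseteq> {x. a \<bullet> x = 0}"
      using a by (auto simp: nabla_eq inner_fundamental)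
    then show "span (nabla Delta - {l}) \<subseteq> {x. a \<bullet> x = 0}"
      by (rule span_minimal) (rule subspace_hyperplane)
    show "{x. a \<bullet> x = 0} \<subseteq> span (nabla Delta - {l})"
    proof
      fix x assume x: "x \<in> {x. a \<bullet> x = 0}"
      have "(c \<bullet> x) *\<^sub>R fundamental c \<in> span (nabla Delta - {l})" if "c \<in> Delta" for c
      proof (cases "c = a")
        case True
        then show ?thesis using x span_zero by simp
      next
        case False
        then have "fundamental c \<in> nabla Delta - {l}"
          using that a inj_on_fundamental by (auto simp: nabla_eq inj_on_def)
        then show ?thesis by (intro span_scale span_base)
      qed
      then show "x \<in> span (nabla Delta - {l})"
        by (subst fundamental_expansion) (rule span_sum)
    qed
  qed
  then have "H = (\<lambda>x. t + x) ` w ` {x. a \<bullet> x = 0}"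
    by (simp add: H linear_span_image[OF weyl_linear[OF w]])
  also have "\<dots> = {x. w a \<bullet> x = w a \<bullet> t}"
  proof (intro equalityI subsetI)
    fix x assume "x \<in> {x. w a \<bullet> x = w a \<bullet> t}"
    then have "a \<bullet> v (x - t) = 0"
      using weyl_inner[OF w, of a "v (x - t)"] v(2) by (simp add: inner_diff_right)
    moreover have "x = t + w (v (x - t))" using v(2) by simp
    ultimately show "x \<in> (\<lambda>x. t + x) ` w ` {x. a \<bullet> x = 0}" by blast
  qed (auto simp: inner_add_right weyl_inner[OF w])
  finally show ?thesis
    using that weyl_root[OF w] a Delta_subset by blast
qed

text \<open>
  If a wall crosses the segment from \<open>x\<close> to \<open>x - w l\<close>, then reflecting \<open>x - w l\<close> in it gives a point
  of the segment from \<open>x - w l\<close> to \<open>x - s (w l)\<close>, where \<open>s\<close> is the linear part of the reflection.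
\<close>

lemma calB_convex:
  assumes "y \<in> calB Phi Delta sigma0 l x"
  obtains v w t where "v \<in> weyl Phi" "w \<in> weyl Phi" "0 \<le> t" "t \<le> 1"
    "y = x - ((1 - t) *\<^sub>R v l + t *\<^sub>R w l)"
proof -
  have neg: "w (- l) = - w l" if "w \<in> weyl Phi" for w
    using linear_neg[OF weyl_linear[OF that]] .
  consider w where "w \<in> weyl Phi" "y = x + w (- l)"
    | H w where "w \<in> weyl Phi" "H \<in> walls Phi Delta" "wall_separates H x {x + w (- l)}"
        "y = wall_reflection H (x + w (- l))"
    using assms by (auto simp: calB_def)
  then show ?thesis
  proof cases
    case 1
    then show ?thesis using neg that[of w w 0] by simp
  next
    case 2
    obtain b k where b: "b \<in> Phi" and H: "H = {x. b \<bullet> x = k}"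
      using wall_hyperplane[OF 2(2)] by blast
    have "b \<noteq> 0" using b zero_not_root by auto
    define x' where "x' = x - w l"
    have x': "x + w (- l) = x'" using neg[OF 2(1)] by (simp add: x'_def)
    \<comment> \<open>Up to a common positive factor, \<open>p\<close> and \<open>q\<close> are the
      signed distances of \<open>x\<close> and \<open>x'\<close> from the wall.\<close>
    define p q where "p = b \<bullet> x - k" and "q = b \<bullet> x' - k"
    have "p \<noteq> 0" "q \<noteq> 0"
      using 2(3) unfolding x' by (auto simp: wall_separates_def H p_def q_def)
    obtain s where s: "0 \<le> s" "s \<le> 1" "(1 - s) *\<^sub>R x + s *\<^sub>R x' \<in> H"
      using 2(3) unfolding x' by (auto simp: wall_separates_def closed_segment_def)
    then have pq: "(1 - s) * p + s * q = 0"
      by (simp add: H p_def q_def inner_add_right algebra_simps)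
    \<comment> \<open>As the segment meets the wall, \<open>p\<close> and \<open>q\<close> have
      opposite signs and \<open>t\<close> lies between 0 and 1. Since
      \<open>b \<bullet> w l = p - q\<close>, the reflection in the wall moves \<open>x'\<close> by
      \<open>t\<close> times the displacement that replacing \<open>w l\<close> by its full root
      reflection would cause.\<close>
    define t where "t = q / (q - p)"
    have t: "0 \<le> t \<and> t \<le> 1 \<and> q \<noteq> p"
    proof (cases "p > 0")
      case True
      then have "q < 0"
        using pq s \<open>q \<noteq> 0\<close> by (smt (verit) mult_nonneg_nonneg mult_pos_pos mult_eq_0_iff)
      then show ?thesis using True by (simp add: t_def divide_simps)
    next
      case False
      then have "p < 0" using \<open>p \<noteq> 0\<close> by simp
      have "q > 0"
      proof (rule ccontr)
        assume "\<not> q > 0"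
        then have "q < 0" using \<open>q \<noteq> 0\<close> by simp
        have "(1 - s) * p \<le> 0" "s * q \<le> 0"
          using s \<open>p < 0\<close> \<open>q < 0\<close> by (simp_all add: mult_nonneg_nonpos)
        then have "(1 - s) * p = 0" "s * q = 0" using pq by linarith+
        then show False using \<open>p \<noteq> 0\<close> \<open>q \<noteq> 0\<close> by simp
      qed
      then show ?thesis using \<open>p < 0\<close> by (simp add: t_def divide_simps)
    qed
    have bwl: "b \<bullet> w l = p - q"
      by (simp add: p_def q_def x'_def inner_diff_right)
    have tq: "t * (p - q) = - q" using t by (simp add: t_def field_simps)
    have "y = x' - (2 * q / (b \<bullet> b)) *\<^sub>R b"
      using 2(4) wall_reflection_hyperplane[OF \<open>b \<noteq> 0\<close>, of k x'] by (simp add: x' H q_def)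
    also have "\<dots> = x - (w l - (t * (2 * (p - q) / (b \<bullet> b))) *\<^sub>R b)"
    proof -
      have "t * (2 * (p - q) / (b \<bullet> b)) = - (2 * q / (b \<bullet> b))"
        using tq by (simp add: divide_simps) (simp add: algebra_simps)
      then show ?thesis by (simp add: x'_def)
    qed
    also have "\<dots> = x - ((1 - t) *\<^sub>R w l + t *\<^sub>R (root_reflection b \<circ> w) l)"
      by (simp add: root_reflection_def bwl algebra_simps)
    finally show ?thesis
      using that[OF 2(1) weyl.intros(2)[OF b 2(1)]] t by blast
  qed
qed

text \<open>Expand the squared norms: \<open>w\<close> preserves the square of \<open>c\<close>, and
  every other inner product is bounded by \<open>dominant_inner_weyl_le\<close>.\<close>

lemma norm_dominant_sum_max:
  assumes "w \<in> weyl Phi" "dominant c" "\<And>l. l \<in> Q \<Longrightarrow> u l \<in> weyl Phi" "\<And>l. l \<in> Q \<Longrightarrow> dominant l"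
  shows "norm (w c + (\<Sum>l\<in>Q. u l l)) \<le> norm (c + \<Sum>Q)"
proof -
  have "w c \<bullet> (\<Sum>l\<in>Q. u l l) \<le> c \<bullet> \<Sum>Q"
    unfolding inner_sum_right by (intro sum_mono dominant_inner_weyl_le[of w "u _"] assms)
  moreover have "(\<Sum>l\<in>Q. u l l) \<bullet> (\<Sum>l\<in>Q. u l l) \<le> \<Sum>Q \<bullet> \<Sum>Q"
    unfolding inner_sum_right inner_sum_left
    by (intro sum_mono dominant_inner_weyl_le[of "u _" "u _"] assms)
  ultimately show ?thesis
    using weyl_inner[OF assms(1), of c c]
    by (simp add: norm_le inner_add_left inner_add_right inner_commute)
qed

section \<open>The degree of a pair: evaluation, removal of a coweight, and convexity\<close>

lemma dominant_subset_nabla: "Q \<subseteq> nabla Delta \<Longrightarrow> l \<in> Q \<Longrightarrow> dominant l"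
  using dominant_nabla by blast

text \<open>The families in \<open>eps_of\<close> are total functions, but only their restrictions
  to \<open>Q\<close> matter, and there are finitely many of these. This makes \<open>Max\<close>
  meaningful.\<close>

lemma eps_of_set_finite:
  assumes "Q \<subseteq> nabla Delta"
  shows "finite {norm (z - (\<Sum>l\<in>Q. w l l) - z0) | w. \<forall>l\<in>Q. w l \<in> weyl Phi}" (is "finite ?S")
proof (rule finite_subset)
  show "?S \<subseteq> (\<lambda>w. norm (z - (\<Sum>l\<in>Q. w l l) - z0)) ` (Q \<rightarrow>\<^sub>E weyl Phi)"
  proof
    fix r assume "r \<in> ?S"
    then obtain w where w: "\<forall>l\<in>Q. w l \<in> weyl Phi" "r = norm (z - (\<Sum>l\<in>Q. w l l) - z0)" by blast
    have "(\<Sum>l\<in>Q. restrict w Q l l) = (\<Sum>l\<in>Q. w l l)"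
      by (rule sum.cong) auto
    then show "r \<in> (\<lambda>w. norm (z - (\<Sum>l\<in>Q. w l l) - z0)) ` (Q \<rightarrow>\<^sub>E weyl Phi)"
      using w by (intro image_eqI[of _ _ "restrict w Q"]) auto
  qed
  have "finite Q" using assms finite_nabla finite_subset by blast
  then show "finite ((\<lambda>w. norm (z - (\<Sum>l\<in>Q. w l l) - z0)) ` (Q \<rightarrow>\<^sub>E weyl Phi))"
    using finite_weyl by (intro finite_imageI finite_PiE) auto
qed

lemma eps_of_upper:
  assumes "Q \<subseteq> nabla Delta" "\<And>l. l \<in> Q \<Longrightarrow> w l \<in> weyl Phi"
  shows "norm (z - (\<Sum>l\<in>Q. w l l) - z0) \<le> eps_of Phi z0 z Q"
  unfolding eps_of_def by (rule Max_ge[OF eps_of_set_finite[OF assms(1)]]) (use assms(2) in blast)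

lemma eps_of_eq:
  assumes "Q \<subseteq> nabla Delta" "w \<in> weyl Phi" "dominant c" "z0 - z = w c"
  shows "eps_of Phi z0 z Q = norm (c + \<Sum>Q)"
proof -
  have eq: "norm (z - (\<Sum>l\<in>Q. u l l) - z0) = norm (w c + (\<Sum>l\<in>Q. u l l))" for u
    unfolding assms(4)[symmetric] by (subst norm_minus_cancel[symmetric]) (simp add: algebra_simps)
  show ?thesis
    unfolding eps_of_def
  proof (rule Max_eqI[OF eps_of_set_finite[OF assms(1)]])
    show "r \<le> norm (c + \<Sum>Q)"
      if "r \<in> {norm (z - (\<Sum>l\<in>Q. w l l) - z0) | w. \<forall>l\<in>Q. w l \<in> weyl Phi}" for r
      using that norm_dominant_sum_max[OF assms(2,3)] dominant_subset_nabla[OF assms(1)]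
      unfolding eq by blast
    \<comment> \<open>The constant family \<open>w\<close> attains the bound, since \<open>w\<close>
      is a linear isometry.\<close>
    have "norm (c + \<Sum>Q) = norm (w c + (\<Sum>l\<in>Q. w l))"
      using weyl_norm[OF assms(2), of "c + \<Sum>Q"] weyl_linear[OF assms(2)]
      by (simp add: linear_add linear_sum)
    then show "norm (c + \<Sum>Q) \<in> {norm (z - (\<Sum>l\<in>Q. w l l) - z0) | w. \<forall>l\<in>Q. w l \<in> weyl Phi}"
      using assms(2) unfolding eq by (intro CollectI exI[of _ "\<lambda>_. w"]) auto
  qed
qed

lemma eps_of_attained:
  assumes "Q \<subseteq> nabla Delta"
  obtains w where "w \<in> weyl Phi" "eps_of Phi z0 z Q = norm (z - (\<Sum>l\<in>Q. w l) - z0)"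
proof -
  obtain w c where w: "w \<in> weyl Phi" "dominant c" "z0 - z = w c"
    using exists_dominant_conjugate[of "z0 - z"] by blast
  have "norm (z - (\<Sum>l\<in>Q. w l) - z0) = norm ((z0 - z) + (\<Sum>l\<in>Q. w l))"
    by (subst norm_minus_cancel[symmetric]) (simp add: algebra_simps)
  also have "\<dots> = norm (w (c + \<Sum>Q))"
    using weyl_linear[OF w(1)] by (simp add: w(3) linear_add linear_sum)
  finally show ?thesis
    using that[OF w(1)] eps_of_eq[OF assms w] weyl_norm[OF w(1)] by simp
qed

text \<open>The decomposition \<open>z0 - z = w c\<close> depends on \<open>z\<close> only and so
  serves both sets. The squared norms differ by \<open>2 * (s \<bullet> l) + l \<bullet> l\<close>,
  which is positive.\<close>

lemma eps_of_remove_less: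
  assumes "Q \<subseteq> nabla Delta" "l \<in> Q"
  shows "eps_of Phi z0 z (Q - {l}) < eps_of Phi z0 z Q"
proof -
  obtain w c where w: "w \<in> weyl Phi" "dominant c" "z0 - z = w c"
    using exists_dominant_conjugate[of "z0 - z"] by blast
  define s where "s = c + \<Sum>(Q - {l})"
  have s: "dominant s"
    unfolding s_def using w(2) dominant_subset_nabla[OF assms(1)] by (intro dominant_add dominant_sum) auto
  have "finite Q" using assms(1) finite_nabla finite_subset by blast
  then have sum: "c + \<Sum>Q = s + l"
    using assms(2) by (simp add: s_def sum.remove[of Q l] algebra_simps)
  have "0 \<le> s \<bullet> l"
    using s dominant_subset_nabla[OF assms] by (rule dominant_inner_nonneg)
  moreover have "l \<noteq> 0"
    using assms by (auto simp: nabla_def)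
  ultimately have "norm s < norm (s + l)"
    by (simp add: norm_lt inner_add_left inner_add_right inner_commute add_nonneg_pos)
  moreover have "eps_of Phi z0 z (Q - {l}) = norm s"
    unfolding s_def using assms(1) by (intro eps_of_eq[OF _ w]) auto
  ultimately show ?thesis
    using eps_of_eq[OF assms(1) w] sum by simp
qed

text \<open>Take a \<open>u\<close> that attains the degree on the left. By
  \<open>calB_convex\<close> the vector whose norm is measured is a convex combination of two
  vectors that compete in the maximum for \<open>(z, Q)\<close>.\<close>

lemma eps_of_calB_le:
  assumes "Q \<subseteq> nabla Delta" "l \<in> Q" "y \<in> calB Phi Delta sigma0 l z"
  shows "eps_of Phi z0 y (Q - {l}) \<le> eps_of Phi z0 z Q"
proof -
  obtain v w t where vw: "v \<in> weyl Phi" "w \<in> weyl Phi" and t: "0 \<le> t" "t \<le> 1"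
    and y: "y = z - ((1 - t) *\<^sub>R v l + t *\<^sub>R w l)"
    using calB_convex[OF assms(3)] by metis
  have "Q - {l} \<subseteq> nabla Delta" using assms(1) by blast
  then obtain u where u: "u \<in> weyl Phi"
    "eps_of Phi z0 y (Q - {l}) = norm (y - (\<Sum>m\<in>Q - {l}. u m) - z0)"
    using eps_of_attained by metis
  \<comment> \<open>\<open>p g\<close> belongs to the family that assigns \<open>g\<close> to
    \<open>l\<close> and \<open>u\<close> to every other element of \<open>Q\<close>.\<close>
  define p where "p g = z - g l - (\<Sum>m\<in>Q - {l}. u m) - z0" for g :: "'a \<Rightarrow> 'a"
  have p: "norm (p g) \<le> eps_of Phi z0 z Q" if "g \<in> weyl Phi" for g
  proof -
    have "finite Q" using assms(1) finite_nabla finite_subset by blast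
    then have "(\<Sum>m\<in>Q. (if m = l then g else u) m) = g l + (\<Sum>m\<in>Q - {l}. u m)"
      using assms(2) by (subst sum.remove[of Q l]) auto
    then have "p g = z - (\<Sum>m\<in>Q. (if m = l then g else u) m) - z0"
      by (simp add: p_def algebra_simps)
    then show ?thesis
      using eps_of_upper[OF assms(1), of "\<lambda>m. if m = l then g else u" z z0] that u(1) by simp
  qed
  have "y - (\<Sum>m\<in>Q - {l}. u m) - z0 = (1 - t) *\<^sub>R p v + t *\<^sub>R p w"
    by (simp add: y p_def algebra_simps)
  then have "eps_of Phi z0 y (Q - {l}) \<le> (1 - t) * norm (p v) + t * norm (p w)"
    using u(2) t norm_triangle_ineq[of "(1 - t) *\<^sub>R p v" "t *\<^sub>R p w"] by simp
  also have "\<dots> \<le> (1 - t) * eps_of Phi z0 z Q + t * eps_of Phi z0 z Q"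
    using p vw t by (intro add_mono mult_left_mono) auto
  finally show ?thesis by (simp add: algebra_simps)
qed

end

sublocale apartment \<subseteq> based_root_system
  by unfold_locales (rule base)

section \<open>The pairs of degree exactly eps\<close>

context apartment
begin

lemma pairs_eps_eq:
  assumes "eps \<in> calE Phi z0"
  shows "pairs_eps Phi Delta z0 eps = {(z, Q) \<in> pairs Phi Delta. eps_of Phi z0 z Q = eps}"
proof -
  obtain x where x: "x \<in> coweight_lattice Phi" "norm (x - z0) = eps"
    using assms by (auto simp: calE_def)
  have z_eps: "z_eps Phi z0 eps = x"
    unfolding z_eps_def by (rule the_equality) (use x z0_generic in auto)
  define w where "w = w_of Phi Delta z0 x"
  \<comment> \<open>The choice in \<open>w_of\<close> has the desired property as soon as some Weyl
    group element has it, and \<open>exists_dominant_conjugate\<close> provides one.\<close>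
  have "w \<in> weyl Phi \<and> x \<in> (\<lambda>c. z0 - w c) ` closed_cone Delta"
  proof -
    obtain v c where "v \<in> weyl Phi" "dominant c" "z0 - x = v c"
      using exists_dominant_conjugate by blast
    then have "v \<in> weyl Phi \<and> x \<in> (\<lambda>c. z0 - v c) ` closed_cone Delta"
      unfolding closed_cone_eq by (auto intro!: image_eqI[of _ _ c] simp: algebra_simps)
    then show ?thesis
      unfolding w_def w_of_def by (rule someI[where P = "\<lambda>w. w \<in> weyl Phi \<and>
        x \<in> (\<lambda>c. z0 - w c) ` closed_cone Delta"])
  qed
  then obtain c where w: "w \<in> weyl Phi" and c: "dominant c" "z0 - x = w c"
    by (auto simp: closed_cone_eq)
  have norm_c: "norm c = eps"
    using x(2) weyl_norm[OF w, of c] c(2) by (metis norm_minus_commute)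
  obtain v where v: "v \<in> weyl Phi" "\<And>y. v (w y) = y" "\<And>y. w (v y) = y"
    using weyl_inverse[OF w] by metis
  have Q_eps: "Q_eps Phi Delta z0 eps = {l \<in> nabla Delta. dominant (c - l)}"
  proof -
    have "x + w l \<in> (\<lambda>c. z0 - w c) ` closed_cone Delta \<longleftrightarrow> dominant (c - l)" for l
    proof
      assume "x + w l \<in> (\<lambda>c. z0 - w c) ` closed_cone Delta"
      then obtain d where d: "dominant d" "x + w l = z0 - w d" by (auto simp: closed_cone_eq)
      have "w d = w (c - l)"
        using d(2) c(2) by (simp add: linear_diff[OF weyl_linear[OF w]] algebra_simps)
      then have "d = c - l" using v(2) by metis
      then show "dominant (c - l)" using d(1) by simp
    next
      assume "dominant (c - l)"
      moreover have "x + w l = z0 - w (c - l)"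
        using c(2) by (simp add: linear_diff[OF weyl_linear[OF w]] algebra_simps)
      ultimately show "x + w l \<in> (\<lambda>c. z0 - w c) ` closed_cone Delta"
        by (auto simp: closed_cone_eq)
    qed
    then show ?thesis
      by (simp add: Q_eps_def Let_def z_eps w_def[symmetric])
  qed
  have pairs_eps: "pairs_eps Phi Delta z0 eps =
      {(x + (\<Sum>l\<in>Q. w l), Q) | Q. Q \<subseteq> {l \<in> nabla Delta. dominant (c - l)}}"
    by (simp add: pairs_eps_def Let_def Q_eps z_eps w_def[symmetric])
  show ?thesis
  proof (intro equalityI subsetI)
    fix zQ assume "zQ \<in> pairs_eps Phi Delta z0 eps"
    then obtain Q where zQ: "zQ = (x + (\<Sum>l\<in>Q. w l), Q)"
      and Q: "Q \<subseteq> {l \<in> nabla Delta. dominant (c - l)}"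
      unfolding pairs_eps by blast
    have Qn: "Q \<subseteq> nabla Delta" using Q by blast
    have fin: "finite Q" using Qn finite_nabla finite_subset by blast
    \<comment> \<open>A simple root is non-zero on at most one element of \<open>Q\<close>, so
      dominance of each single \<open>c - l\<close>, together with that of \<open>c\<close>,
      suffices.\<close>
    have "dominant (c - \<Sum>Q)"
      unfolding dominant_def
    proof
      fix a assume a: "a \<in> Delta"
      have pair: "a \<bullet> l = (if l = fundamental a then 1 else 0)" if "l \<in> Q" for l
        using that Qn a inj_on_fundamental by (auto simp: nabla_eq inner_fundamental inj_on_def)
      have "a \<bullet> \<Sum>Q = (\<Sum>l\<in>Q. if l = fundamental a then 1 else 0)"
        unfolding inner_sum_right using pair by (rule sum.cong[OF refl])
      also have "\<dots> = (if fundamental a \<in> Q then 1 else 0)"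
        using fin by simp
      also have "\<dots> \<le> a \<bullet> c"
        using Q c(1) a inner_fundamental[OF a a] by (force simp: dominant_def inner_diff_right)
      finally show "0 \<le> a \<bullet> (c - \<Sum>Q)" by (simp add: inner_diff_right)
    qed
    moreover have "z0 - (x + (\<Sum>l\<in>Q. w l)) = w (c - \<Sum>Q)"
      using c(2) by (simp add: linear_diff[OF weyl_linear[OF w]] linear_sum[OF weyl_linear[OF w]] algebra_simps)
    ultimately have "eps_of Phi z0 (x + (\<Sum>l\<in>Q. w l)) Q = eps"
      using eps_of_eq[OF Qn w] norm_c by simp
    moreover have "x + (\<Sum>l\<in>Q. w l) \<in> coweight_lattice Phi"
      using x(1) Qn nabla_coweight_lattice weyl_coweight_lattice[OF w]
      by (intro coweight_lattice_add coweight_lattice_sum) auto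
    ultimately show "zQ \<in> {(z, Q) \<in> pairs Phi Delta. eps_of Phi z0 z Q = eps}"
      using Qn zQ by (simp add: pairs_def)
  next
    fix zQ assume "zQ \<in> {(z, Q) \<in> pairs Phi Delta. eps_of Phi z0 z Q = eps}"
    then obtain z Q where zQ: "zQ = (z, Q)" and z: "z \<in> coweight_lattice Phi"
      and Qn: "Q \<subseteq> nabla Delta" and eps: "eps_of Phi z0 z Q = eps"
      by (auto simp: pairs_def)
    have fin: "finite Q" using Qn finite_nabla finite_subset by blast
    obtain u d where u: "u \<in> weyl Phi" and d: "dominant d" "z0 - z = u d"
      using exists_dominant_conjugate by blast
    \<comment> \<open>This lattice point has distance \<open>eps\<close> from \<open>z0\<close>, so
      genericity identifies it with \<open>x\<close>.\<close>
    have "z - (\<Sum>l\<in>Q. u l) \<in> coweight_lattice Phi"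
      using z Qn nabla_coweight_lattice weyl_coweight_lattice[OF u]
      by (intro coweight_lattice_diff coweight_lattice_sum) auto
    moreover have u_sum: "z0 - (z - (\<Sum>l\<in>Q. u l)) = u (d + \<Sum>Q)"
      using d(2) by (simp add: linear_add[OF weyl_linear[OF u]] linear_sum[OF weyl_linear[OF u]] algebra_simps)
    then have "norm (z - (\<Sum>l\<in>Q. u l) - z0) = norm (x - z0)"
      using eps_of_eq[OF Qn u d] eps x(2) weyl_norm[OF u, of "d + \<Sum>Q"]
      by (simp add: norm_minus_commute)
    ultimately have zx: "z - (\<Sum>l\<in>Q. u l) = x"
      using z0_generic x(1) by blast
    define g where "g = v \<circ> u"
    have g: "g \<in> weyl Phi" unfolding g_def using v(1) u by (rule weyl_comp)
    have gd: "g (d + \<Sum>Q) = c"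
      using u_sum c(2) v(2) unfolding zx g_def by (metis comp_apply)
    have dQ: "dominant (d + \<Sum>Q)"
      using d(1) dominant_subset_nabla[OF Qn] by (intro dominant_add dominant_sum)
    \<comment> \<open>Two dominant vectors in one orbit coincide:
      \<open>c \<bullet> c \<le> c \<bullet> (d + \<Sum>Q)\<close> and the norms are equal.\<close>
    have c_eq: "c = d + \<Sum>Q"
    proof -
      have "c \<bullet> c \<le> c \<bullet> (d + \<Sum>Q)"
        using dominant_inner_weyl_le[OF g weyl.intros(1) dQ c(1)] gd by (simp add: inner_commute)
      moreover have "(d + \<Sum>Q) \<bullet> (d + \<Sum>Q) = c \<bullet> c"
        using weyl_inner[OF g, of "d + \<Sum>Q" "d + \<Sum>Q"] gd by simp
      ultimately have "(c - (d + \<Sum>Q)) \<bullet> (c - (d + \<Sum>Q)) \<le> 0"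
        by (simp only: inner_diff_left inner_diff_right inner_commute)
      then show ?thesis by (metis inner_gt_zero_iff not_less right_minus_eq)
    qed
    have remove: "c = (d + \<Sum>(Q - {l})) + l" if "l \<in> Q" for l
      using fin that by (simp add: c_eq sum.remove[of Q l] algebra_simps)
    have dom: "dominant (d + \<Sum>(Q - {l}))" for l
      using d(1) dominant_subset_nabla[OF Qn] by (intro dominant_add dominant_sum) auto
    \<comment> \<open>\<open>g\<close> fixes \<open>c = e + l\<close>, so
      \<open>c \<bullet> g l = c \<bullet> l\<close>. The part coming from \<open>e\<close> cannot
      grow, hence \<open>l \<bullet> l \<le> l \<bullet> g l\<close>, and equality of norms forces
      \<open>g l = l\<close>.\<close>
    have gl: "g l = l" if "l \<in> Q" for l
    proof -
      define e where "e = d + \<Sum>(Q - {l})"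
      have ce: "c = e + l" using remove[OF that] by (simp add: e_def)
      have l: "dominant l" using dominant_subset_nabla[OF Qn that] .
      have "c \<bullet> g l = c \<bullet> l"
        using weyl_inner[OF g, of c l] gd c_eq by simp
      moreover have "e \<bullet> g l \<le> e \<bullet> l"
        using dominant_inner_weyl_le[OF weyl.intros(1) g _ l, of e] dom by (simp add: e_def)
      ultimately have "l \<bullet> l \<le> l \<bullet> g l"
        by (simp add: ce inner_add_left)
      moreover have "g l \<bullet> g l = l \<bullet> l" by (rule weyl_inner[OF g])
      ultimately have "(g l - l) \<bullet> (g l - l) \<le> 0"
        by (simp add: inner_diff_left inner_diff_right inner_commute)
      then show ?thesis by (metis inner_gt_zero_iff not_less right_minus_eq)
    qed
    have "w l = u l" if "l \<in> Q" for l
      using gl[OF that] v(3)[of "u l"] by (simp add: g_def)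
    then have "z = x + (\<Sum>l\<in>Q. w l)"
      using zx by (simp add: algebra_simps)
    moreover have "dominant (c - l)" if "l \<in> Q" for l
      using remove[OF that] dom[of l] by (metis add_diff_cancel_right')
    ultimately show "zQ \<in> pairs_eps Phi Delta z0 eps"
      unfolding pairs_eps zQ using Qn by blast
  qed
qed

end

section \<open>Direct sums and cosets\<close>

lemma direct_sum_iff:
  "f \<in> direct_sum F Y \<longleftrightarrow>
    (\<forall>y. Poly_Mapping.lookup f y \<noteq> 0 \<longrightarrow> y \<in> Y \<and> Poly_Mapping.lookup f y \<in> F y)"
  by (auto simp: direct_sum_def in_keys_iff)

text \<open>Chains are an outer direct sum over the sets \<open>Q\<close> of inner direct sums over
  the points; facts on \<open>direct_sum\<close> can thus be applied twice.\<close>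

lemma summands_eq_direct_sum:
  "summands F S j = direct_sum (\<lambda>Q. direct_sum F {z. (z, Q) \<in> S}) {Q. card Q = j}"
  by (auto simp: summands_def direct_sum_def)

lemma summands_iff:
  "c \<in> summands F S j \<longleftrightarrow> (\<forall>Q z. Poly_Mapping.lookup (Poly_Mapping.lookup c Q) z \<noteq> 0 \<longrightarrow>
     card Q = j \<and> (z, Q) \<in> S \<and> Poly_Mapping.lookup (Poly_Mapping.lookup c Q) z \<in> F z)"
proof (intro iffI allI impI)
  fix Q z assume c: "c \<in> summands F S j" and z: "Poly_Mapping.lookup (Poly_Mapping.lookup c Q) z \<noteq> 0"
  then have "Poly_Mapping.lookup c Q \<noteq> 0" by auto
  then show "card Q = j \<and> (z, Q) \<in> S \<and> Poly_Mapping.lookup (Poly_Mapping.lookup c Q) z \<in> F z"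
    using c z by (simp add: summands_eq_direct_sum direct_sum_iff)
next
  assume *: "\<forall>Q z. Poly_Mapping.lookup (Poly_Mapping.lookup c Q) z \<noteq> 0 \<longrightarrow>
     card Q = j \<and> (z, Q) \<in> S \<and> Poly_Mapping.lookup (Poly_Mapping.lookup c Q) z \<in> F z"
  have "card Q = j" if "Poly_Mapping.lookup c Q \<noteq> 0" for Q
  proof -
    obtain z where "Poly_Mapping.lookup (Poly_Mapping.lookup c Q) z \<noteq> 0"
      using \<open>Poly_Mapping.lookup c Q \<noteq> 0\<close> by (metis lookup_zero poly_mapping_eqI)
    then show ?thesis using * by blast
  qed
  then show "c \<in> summands F S j"
    using * by (simp add: summands_eq_direct_sum direct_sum_iff)
qed

lemma summands_mono: "S \<subseteq> S' \<Longrightarrow> summands F S j \<subseteq> summands F S' j"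
  unfolding summands_iff subset_iff by blast

lemma sum_single_lookup:
  "(\<Sum>k\<in>Poly_Mapping.keys f. Poly_Mapping.single k (Poly_Mapping.lookup f k)) = f"
  by (rule poly_mapping_eqI)
    (simp add: lookup_sum lookup_single when_def in_keys_iff)

lemma lookup_chain_proj:
  "Poly_Mapping.lookup (Poly_Mapping.lookup (chain_proj S c) Q) z =
    (if (z, Q) \<in> S then Poly_Mapping.lookup (Poly_Mapping.lookup c Q) z else 0)"
  by (auto simp: chain_proj_def lookup_mapp when_def in_keys_iff)

lemma chain_proj_summands:
  "c \<in> summands F M j \<Longrightarrow> P \<subseteq> M \<Longrightarrow> chain_proj P c \<in> summands F P j"
  by (auto simp: summands_iff lookup_chain_proj)

lemma diff_chain_proj_summands:
  "c \<in> summands F M j \<Longrightarrow> c - chain_proj P c \<in> summands F (M - P) j"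
  by (auto simp: summands_iff lookup_chain_proj lookup_minus)

text \<open>Scaling of chains is the coefficientwise scaling iterated, so
  \<open>module_dscale\<close> at the inner module yields the module structure on chains.\<close>

lemma cscale_eq_dscale: "cscale smul = dscale (dscale smul)"
  by (intro ext) (simp add: cscale_def dscale_def)

context module
begin

lemma module_dscale: "module (dscale scale)"
  by unfold_locales
    (auto intro!: poly_mapping_eqI simp: lookup_dscale lookup_add scale_right_distrib scale_left_distrib)

lemma subspace_direct_sum:
  assumes "\<And>y. y \<in> Y \<Longrightarrow> subspace (F y)"
  shows "module.subspace (dscale scale) (direct_sum F Y)"
proof -
  have "Poly_Mapping.lookup f y \<in> F y" if "f \<in> direct_sum F Y" "y \<in> Y" for f y
    using that assms subspace_0 by (metis direct_sum_iff)
  moreover have "y \<in> Y" if "f \<in> direct_sum F Y" "Poly_Mapping.lookup f y \<noteq> 0" for f y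
    using that by (auto simp: direct_sum_iff)
  ultimately show ?thesis
    unfolding module.subspace_def[OF module_dscale] direct_sum_iff[where f = "_ + _"]
      direct_sum_iff[where f = "dscale _ _ _"] lookup_add lookup_dscale
    by (auto simp: direct_sum_iff[where f = 0])
      (metis add_0 assms subspace_add scale_zero_right subspace_scale)+
qed

lemma coset_eq_iff:
  assumes "subspace N"
  shows "a +o N = b +o N \<longleftrightarrow> a - b \<in> N"
proof
  assume "a +o N = b +o N"
  moreover have "a \<in> a +o N"
    using subspace_0[OF assms] by (force simp: elt_set_plus_def)
  ultimately show "a - b \<in> N" by (auto simp: elt_set_plus_def)
next
  assume ab: "a - b \<in> N"
  have "x \<in> a +o N \<longleftrightarrow> x - a \<in> N" for x a
    by (auto simp: elt_set_plus_def intro: bexI[of _ "x - a"])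
  moreover have "x - a \<in> N \<longleftrightarrow> x - b \<in> N" for x
    using subspace_add[OF assms ab, of "x - a"] subspace_diff[OF assms _ ab, of "x - b"]
    by (auto simp: algebra_simps)
  ultimately show "a +o N = b +o N" by blast
qed

lemma coset_plus_coset:
  assumes "subspace N"
  shows "(a +o N) + (b +o N) = (a + b) +o N"
proof -
  have "N + N = N"
  proof
    show "N + N \<subseteq> N" using subspace_add[OF assms] by (auto simp: set_plus_def)
    show "N \<subseteq> N + N" using subspace_0[OF assms] by (force simp: set_plus_def)
  qed
  then show ?thesis by (simp add: set_plus_rearrange)
qed

text \<open>Additivity is asked for on \<open>c + n\<close> only, because for the Koszul
  differential it is established only on chains with coefficients in the modules
  \<open>F\<close>.\<close>

lemma coset_map_coset:
  fixes h :: "'c::ab_group_add \<Rightarrow> 'b"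
  assumes "subspace N'" "0 \<in> N" "\<And>n. n \<in> N \<Longrightarrow> h (c + n) = h c + h n" "h ` N \<subseteq> N'"
  shows "coset_map h N' (c +o N) = h c +o N'"
proof (intro equalityI subsetI)
  fix x assume "x \<in> coset_map h N' (c +o N)"
  then obtain n n' where "n \<in> N" "n' \<in> N'" "x = h c + (h n + n')"
    using assms(3) by (auto simp: coset_map_def set_plus_def elt_set_plus_def add.assoc)
  then show "x \<in> h c +o N'"
    using assms(1,4) subspace_add by (auto simp: elt_set_plus_def)
next
  fix x assume "x \<in> h c +o N'"
  then obtain n' where "n' \<in> N'" "x = h (c + 0) + n'" by (auto simp: elt_set_plus_def)
  then show "x \<in> coset_map h N' (c +o N)"
    using assms(2) by (auto simp: coset_map_def set_plus_def elt_set_plus_def)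
qed

end

section \<open>The Koszul complex\<close>

context vertex_coefficient_system
begin

interpretation D: module "dscale smul"
  by (rule module_dscale)

interpretation C: module "cscale smul"
  unfolding cscale_eq_dscale by (rule D.module_dscale)

lemma direct_sum_subspace:
  "Y \<subseteq> coweight_lattice Phi \<Longrightarrow> D.subspace (direct_sum F Y)"
  using F_module by (intro subspace_direct_sum) auto

lemma summands_subspace: "S \<subseteq> pairs Phi Delta \<Longrightarrow> C.subspace (summands F S j)"
  unfolding summands_eq_direct_sum cscale_eq_dscale
  by (intro D.subspace_direct_sum direct_sum_subspace) (auto simp: pairs_def)

lemma T_zero: "l \<in> nabla Delta \<Longrightarrow> T l 0 = 0"
  using T_add[of l 0 0] D.subspace_0[OF direct_sum_subspace[OF subset_refl]] by simp

lemma T_sum: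
  assumes "l \<in> nabla Delta" "\<And>i. i \<in> I \<Longrightarrow> f i \<in> direct_sum F (coweight_lattice Phi)"
  shows "T l (\<Sum>i\<in>I. f i) = (\<Sum>i\<in>I. T l (f i))"
  using assms(2)
proof (induction I rule: infinite_finite_induct)
  case (insert i I)
  then show ?case
    using T_add[OF assms(1), of "f i" "sum f I"] D.subspace_sum[OF direct_sum_subspace[OF subset_refl], of I f]
    by simp
qed (simp_all add: T_zero assms(1))

text \<open>Locality is an axiom for elements supported at one point; splitting \<open>f\<close>
  into such elements extends it. \<open>T_closed\<close> keeps the values on the lattice, so only
  lattice points of \<open>calB\<close> have to lie in \<open>Z\<close>.\<close>

lemma T_direct_sum:
  assumes l: "l \<in> nabla Delta" and f: "f \<in> direct_sum F Y"
    and Y: "Y \<subseteq> coweight_lattice Phi" and Z: "Z \<subseteq> coweight_lattice Phi"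
    and YZ: "\<And>y. y \<in> Y \<Longrightarrow> calB Phi Delta sigma0 l y \<inter> coweight_lattice Phi \<subseteq> Z"
  shows "T l f \<in> direct_sum F Z"
proof -
  define s where "s y = Poly_Mapping.single y (Poly_Mapping.lookup f y)" for y
  have y: "y \<in> Y" "s y \<in> direct_sum F {y}" "s y \<in> direct_sum F (coweight_lattice Phi)"
    if "y \<in> Poly_Mapping.keys f" for y
  proof -
    show "y \<in> Y" using f that by (auto simp: direct_sum_def)
    show "s y \<in> direct_sum F {y}"
      using f that by (auto simp: direct_sum_def s_def lookup_single when_def)
    then show "s y \<in> direct_sum F (coweight_lattice Phi)"
      using \<open>y \<in> Y\<close> Y by (auto simp: direct_sum_def)
  qed
  have "T l (s y) \<in> direct_sum F Z" if "y \<in> Poly_Mapping.keys f" for y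
    using T_local[OF l _ y(2)[OF that]] T_closed[OF l y(3)[OF that]] YZ[OF y(1)[OF that]] y(1)[OF that] Y
    by (auto simp: direct_sum_def)
  then have "(\<Sum>y\<in>Poly_Mapping.keys f. T l (s y)) \<in> direct_sum F Z"
    by (intro D.subspace_sum direct_sum_subspace Z)
  moreover have "T l f = (\<Sum>y\<in>Poly_Mapping.keys f. T l (s y))"
    using T_sum[OF l y(3), of "Poly_Mapping.keys f" "\<lambda>y. y"] sum_single_lookup[of f]
    by (simp add: s_def)
  ultimately show ?thesis by simp
qed

section \<open>Effect of the differential on the indexing pairs, and its additivity\<close>

lemma single_summands:
  "f \<in> direct_sum F {z. (z, Q) \<in> S} \<Longrightarrow> Poly_Mapping.single Q f \<in> summands F S (card Q)"
  by (auto simp: summands_iff direct_sum_iff lookup_single when_def)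

lemma lookup_summands:
  assumes "c \<in> summands F S j" "S \<subseteq> pairs Phi Delta" "Q \<in> Poly_Mapping.keys c"
  shows "card Q = j" "Q \<subseteq> nabla Delta" "Poly_Mapping.lookup c Q \<in> direct_sum F {z. (z, Q) \<in> S}"
proof -
  show "card Q = j" "Poly_Mapping.lookup c Q \<in> direct_sum F {z. (z, Q) \<in> S}"
    using assms by (auto simp: summands_eq_direct_sum direct_sum_def[of "\<lambda>Q. direct_sum F {z. (z, Q) \<in> S}"])
  obtain z where "z \<in> Poly_Mapping.keys (Poly_Mapping.lookup c Q)"
    using assms(3) by (metis all_not_in_conv in_keys_iff keys_eq_empty)
  then have "(z, Q) \<in> S" using assms(1,3) by (auto simp: summands_def)
  then show "Q \<subseteq> nabla Delta" using assms(2) by (auto simp: pairs_def)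
qed

text \<open>A criterion on index sets that serves both filtration steps: \<open>remove\<close> takes
  care of the terms with \<open>alpha\<close>, \<open>calB\<close> of the terms with
  \<open>T\<close>.\<close>

lemma koszul_d_summands:
  assumes c: "c \<in> summands F S (Suc j)" and S: "S \<subseteq> pairs Phi Delta" and S': "S' \<subseteq> pairs Phi Delta"
    and remove: "\<And>z Q l. (z, Q) \<in> S \<Longrightarrow> l \<in> Q \<Longrightarrow> (z, Q - {l}) \<in> S'"
    and calB: "\<And>z Q l y. (z, Q) \<in> S \<Longrightarrow> l \<in> Q \<Longrightarrow> y \<in> calB Phi Delta sigma0 l z \<Longrightarrow>
      y \<in> coweight_lattice Phi \<Longrightarrow> (y, Q - {l}) \<in> S'"
  shows "koszul_d num smul T alpha c \<in> summands F S' j"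
  unfolding koszul_d_def
proof (intro C.subspace_sum summands_subspace S')
  fix Q l assume Q: "Q \<in> Poly_Mapping.keys c" and l: "l \<in> Q"
  note Q = lookup_summands[OF c S Q]
  have card: "card (Q - {l}) = j"
    using Q(1) l by (simp add: card_Diff_singleton)
  have sub: "{z. (z, Q - {l}) \<in> S'} \<subseteq> coweight_lattice Phi" "{z. (z, Q) \<in> S} \<subseteq> coweight_lattice Phi"
    using S S' by (auto simp: pairs_def)
  have "T l (Poly_Mapping.lookup c Q) \<in> direct_sum F {z. (z, Q - {l}) \<in> S'}"
    using l Q(2) calB by (intro T_direct_sum[OF _ Q(3) sub(2,1)]) auto
  moreover have "Poly_Mapping.lookup c Q \<in> direct_sum F {z. (z, Q - {l}) \<in> S'}"
    using Q(3) remove l by (auto simp: direct_sum_def)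
  ultimately show "Poly_Mapping.single (Q - {l})
      (dscale smul ((- 1) ^ card {m \<in> Q. num m \<le> num l})
        (T l (Poly_Mapping.lookup c Q) - dscale smul (alpha l) (Poly_Mapping.lookup c Q)))
      \<in> summands F S' j"
    unfolding card[symmetric]
    by (intro single_summands D.subspace_scale D.subspace_diff direct_sum_subspace sub)
qed

text \<open>The terms with \<open>T\<close> cancel. What remains is a multiple of the old
  coefficient, placed at the same points with one coweight removed.\<close>

lemma koszul_d_diff_summands:
  assumes c: "c \<in> summands F S (Suc j)" and S: "S \<subseteq> pairs Phi Delta" and S': "S' \<subseteq> pairs Phi Delta"
    and remove: "\<And>z Q l. (z, Q) \<in> S \<Longrightarrow> l \<in> Q \<Longrightarrow> (z, Q - {l}) \<in> S'"
  shows "koszul_d num smul T alpha c - koszul_d num smul T alpha' c \<in> summands F S' j"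
  unfolding koszul_d_def sum_subtractf[symmetric]
proof (intro C.subspace_sum summands_subspace S')
  fix Q l assume Q: "Q \<in> Poly_Mapping.keys c" and l: "l \<in> Q"
  define e where "e = ((- 1) ^ card {m \<in> Q. num m \<le> num l} :: 'r)"
  define f where "f = Poly_Mapping.lookup c Q"
  note Q = lookup_summands[OF c S Q, folded f_def]
  have card: "card (Q - {l}) = j"
    using Q(1) l by (simp add: card_Diff_singleton)
  have sub: "{z. (z, Q - {l}) \<in> S'} \<subseteq> coweight_lattice Phi"
    using S' by (auto simp: pairs_def)
  have "f \<in> direct_sum F {z. (z, Q - {l}) \<in> S'}"
    using Q(3) remove l by (auto simp: direct_sum_def)
  then have "Poly_Mapping.single (Q - {l})
      (dscale smul e (dscale smul (alpha' l) f - dscale smul (alpha l) f)) \<in> summands F S' j"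
    unfolding card[symmetric]
    by (intro single_summands D.subspace_scale D.subspace_diff direct_sum_subspace sub)
  moreover have "dscale smul e (T l f - dscale smul (alpha l) f) - dscale smul e (T l f - dscale smul (alpha' l) f) =
      dscale smul e (dscale smul (alpha' l) f - dscale smul (alpha l) f)"
    by (simp add: dscale_diff)
  ultimately show "Poly_Mapping.single (Q - {l})
      (dscale smul ((- 1) ^ card {m \<in> Q. num m \<le> num l})
        (T l (Poly_Mapping.lookup c Q) - dscale smul (alpha l) (Poly_Mapping.lookup c Q))) -
    Poly_Mapping.single (Q - {l})
      (dscale smul ((- 1) ^ card {m \<in> Q. num m \<le> num l})
        (T l (Poly_Mapping.lookup c Q) - dscale smul (alpha' l) (Poly_Mapping.lookup c Q)))
    \<in> summands F S' j"
    by (simp add: f_def e_def flip: single_diff)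
qed

lemma koszul_d_add:
  assumes c: "c \<in> summands F S j" and c': "c' \<in> summands F S j" and S: "S \<subseteq> pairs Phi Delta"
  shows "koszul_d num smul T alpha (c + c') = koszul_d num smul T alpha c + koszul_d num smul T alpha c'"
proof -
  define t where "t Q l f = Poly_Mapping.single (Q - {l})
      (dscale smul ((- 1) ^ card {m \<in> Q. num m \<le> num l}) (T l f - dscale smul (alpha l) f))" for Q l f
  \<comment> \<open>The sum in \<open>koszul_d\<close> runs over the support, which differs for
    \<open>c\<close>, \<open>c'\<close> and \<open>c + c'\<close>. Terms outside the support vanish
    by \<open>T_zero\<close>, so all three sums can run over all subsets of
    \<open>nabla\<close>.\<close>
  have d: "koszul_d num smul T alpha b =
      (\<Sum>Q\<in>Pow (nabla Delta). \<Sum>l\<in>Q. t Q l (Poly_Mapping.lookup b Q))"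
    if b: "b \<in> summands F S j" for b
    unfolding koszul_d_def t_def
  proof (rule sum.mono_neutral_left)
    show "finite (Pow (nabla Delta))" using finite_nabla by simp
    show "Poly_Mapping.keys b \<subseteq> Pow (nabla Delta)" using lookup_summands(2)[OF b S] by blast
  qed (auto intro!: sum.neutral simp: in_keys_iff T_zero subsetD)
  have lookup: "Poly_Mapping.lookup b Q \<in> direct_sum F (coweight_lattice Phi)"
    if b: "b \<in> summands F S j" for b Q
  proof (cases "Q \<in> Poly_Mapping.keys b")
    case True
    then show ?thesis
      using lookup_summands(3)[OF b S True] S by (auto simp: direct_sum_def pairs_def)
  qed (simp add: in_keys_iff direct_sum_def)
  have "t Q l (Poly_Mapping.lookup (c + c') Q) =
      t Q l (Poly_Mapping.lookup c Q) + t Q l (Poly_Mapping.lookup c' Q)"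
    if "l \<in> nabla Delta" for Q l
    unfolding t_def lookup_add T_add[OF that lookup[OF c] lookup[OF c']] single_add[symmetric]
    by (simp add: D.scale_right_distrib D.scale_right_diff_distrib algebra_simps)
  then show ?thesis
    unfolding d[OF c] d[OF c'] d[OF C.subspace_add[OF summands_subspace[OF S] c c']] sum.distrib[symmetric]
    by (intro sum.cong refl) blast
qed

section \<open>The two filtration steps and their quotient\<close>

abbreviation pairs_le :: "real \<Rightarrow> ('a \<times> 'a set) set" where
  "pairs_le eps \<equiv> {(z, Q) \<in> pairs Phi Delta. eps_of Phi z0 z Q \<le> eps}"

abbreviation pairs_less :: "real \<Rightarrow> ('a \<times> 'a set) set" where
  "pairs_less eps \<equiv> {(z, Q) \<in> pairs Phi Delta. eps_of Phi z0 z Q < eps}"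

text \<open>The passage from a weak to a strict inequality is what makes \<open>alpha\<close>
  disappear in the quotient.\<close>

lemma pairs_remove_less:
  "(z, Q) \<in> pairs_le eps \<Longrightarrow> l \<in> Q \<Longrightarrow> (z, Q - {l}) \<in> pairs_less eps"
  using eps_of_remove_less[of Q l z0 z] by (auto simp: pairs_def)

lemma pairs_calB:
  assumes "(z, Q) \<in> pairs Phi Delta" "l \<in> Q" "y \<in> calB Phi Delta sigma0 l z"
    "y \<in> coweight_lattice Phi"
  shows "(y, Q - {l}) \<in> pairs Phi Delta" "eps_of Phi z0 y (Q - {l}) \<le> eps_of Phi z0 z Q"
  using assms eps_of_calB_le[of Q l y sigma0 z z0] by (auto simp: pairs_def)

lemma pairs_le_subset: "pairs_le eps \<subseteq> pairs Phi Delta"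
  and pairs_less_subset: "pairs_less eps \<subseteq> pairs Phi Delta"
  by auto

lemma koszul_d_le:
  assumes "c \<in> summands F (pairs_le eps) (Suc j)"
  shows "koszul_d num smul T alpha c \<in> summands F (pairs_le eps) j"
proof (rule koszul_d_summands[OF assms])
  fix z Q l assume zQ: "(z, Q) \<in> pairs_le eps" and l: "l \<in> Q"
  show "(z, Q - {l}) \<in> pairs_le eps"
    using pairs_remove_less[OF zQ l] by auto
  show "(y, Q - {l}) \<in> pairs_le eps"
    if "y \<in> calB Phi Delta sigma0 l z" "y \<in> coweight_lattice Phi" for y
    using pairs_calB[OF _ l that] zQ by (blast intro: order_trans)
qed auto

lemma koszul_d_less:
  assumes "c \<in> summands F (pairs_less eps) (Suc j)"
  shows "koszul_d num smul T alpha c \<in> summands F (pairs_less eps) j"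
proof (rule koszul_d_summands[OF assms])
  fix z Q l assume zQ: "(z, Q) \<in> pairs_less eps" and l: "l \<in> Q"
  then show "(z, Q - {l}) \<in> pairs_less eps"
    by (intro pairs_remove_less) auto
  show "(y, Q - {l}) \<in> pairs_less eps"
    if "y \<in> calB Phi Delta sigma0 l z" "y \<in> coweight_lattice Phi" for y
    using pairs_calB[OF _ l that] zQ by (blast intro: le_less_trans)
qed auto

lemma koszul_d_coset:
  assumes "c \<in> summands F (pairs_le eps) (Suc j)"
  shows "coset_map (koszul_d num smul T alpha) (summands F (pairs_less eps) j)
      (c +o summands F (pairs_less eps) (Suc j)) =
    koszul_d num smul T alpha c +o summands F (pairs_less eps) j"
proof (rule C.coset_map_coset)
  show "koszul_d num smul T alpha (c + n) = koszul_d num smul T alpha c + koszul_d num smul T alpha n"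
    if "n \<in> summands F (pairs_less eps) (Suc j)" for n
  proof (rule koszul_d_add[OF assms])
    show "n \<in> summands F (pairs_le eps) (Suc j)"
      by (rule subsetD[OF summands_mono that]) auto
  qed auto
  show "0 \<in> summands F (pairs_less eps) (Suc j)"
    by (rule C.subspace_0) (auto intro: summands_subspace)
qed (auto intro: summands_subspace koszul_d_less)

text \<open>By \<open>pairs_eps_eq\<close> the pairs in \<open>pairs_eps\<close> are exactly those
  of \<open>pairs_le\<close> outside \<open>pairs_less\<close>. Hence every chain of the larger step
  is its projection plus a chain of the smaller step, and the projection is a canonical
  representative of the coset.\<close>

lemma represents_koszul_quotient:
  assumes "eps \<in> calE Phi z0"
  shows "represents_quotient (cscale smul) (summands F (pairs_eps Phi Delta z0 eps))
    (chain_proj (pairs_eps Phi Delta z0 eps) \<circ> koszul_d num smul T alpha)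
    (summands F (pairs_le eps)) (summands F (pairs_less eps)) (koszul_d num smul T alpha)"
proof -
  define P where "P = pairs_eps Phi Delta z0 eps"
  let ?M = "summands F (pairs_le eps)" and ?N = "summands F (pairs_less eps)"
  have P: "P = {(z, Q) \<in> pairs Phi Delta. eps_of Phi z0 z Q = eps}"
    unfolding P_def by (rule pairs_eps_eq[OF assms])
  have subset: "P \<subseteq> pairs_le eps" "P \<subseteq> pairs Phi Delta" and less: "pairs_le eps - P = pairs_less eps"
    by (auto simp: P)
  have N: "C.subspace (?N j)" for j by (rule summands_subspace) auto
  have DM: "summands F P j \<subseteq> ?M j" for j by (rule summands_mono[OF subset(1)])
  have proj: "chain_proj P c \<in> summands F P j \<and> c - chain_proj P c \<in> ?N j" if "c \<in> ?M j" for c j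
    using chain_proj_summands[OF that subset(1)] diff_chain_proj_summands[OF that, of P]
    unfolding less by blast
  have scale: "cscale smul r (a + b) = cscale smul r a + cscale smul r b" for r a b
    by (rule C.scale_right_distrib)
  show ?thesis
    unfolding represents_quotient_def P_def[symmetric]
  proof (intro conjI allI ballI)
    show "subcomplex (cscale smul) (chain_proj P \<circ> koszul_d num smul T alpha) ?M (summands F P)"
      using DM summands_subspace[OF subset(2)] proj koszul_d_le by (fastforce simp: subcomplex_def)
    show "bij_betw (\<lambda>c. c +o ?N j) (summands F P j) (quotient (?M j) (?N j))" for j
      unfolding bij_betw_def
    proof
      show "inj_on (\<lambda>c. c +o ?N j) (summands F P j)"
      proof (rule inj_onI)
        fix c c' assume c: "c \<in> summands F P j" "c' \<in> summands F P j" "c +o ?N j = c' +o ?N j"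
        \<comment> \<open>A non-zero coefficient of \<open>c - c'\<close> would sit at a pair of
          degree both equal to \<open>eps\<close> and less than \<open>eps\<close>.\<close>
        have "c - c' \<in> ?N j" using c(3) C.coset_eq_iff[OF N] by blast
        moreover have "c - c' \<in> summands F P j"
          using c by (intro C.subspace_diff summands_subspace subset)
        ultimately have "Poly_Mapping.lookup (Poly_Mapping.lookup (c - c') Q) z = 0" for Q z
          by (force simp: summands_iff P)
        then have "c - c' = 0" by (intro poly_mapping_eqI) simp
        then show "c = c'" by simp
      qed
      have "c +o ?N j \<in> (\<lambda>c. c +o ?N j) ` summands F P j" if "c \<in> ?M j" for c
        using proj[OF that] C.coset_eq_iff[OF N, of c j "chain_proj P c"] by blast
      then show "(\<lambda>c. c +o ?N j) ` summands F P j = quotient (?M j) (?N j)"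
        unfolding quotient_def using DM by blast
    qed
    show "(c + c') +o ?N j = (c +o ?N j) + (c' +o ?N j)" for c c' j
      by (rule C.coset_plus_coset[OF N, symmetric])
    show "cscale smul r c +o ?N j = coset_map (cscale smul r) (?N j) (c +o ?N j)" for r c j
      using C.subspace_0[OF N] C.subspace_scale[OF N] scale
      by (intro C.coset_map_coset[OF N, symmetric]) auto
    show "(chain_proj P \<circ> koszul_d num smul T alpha) c +o ?N j =
        coset_map (koszul_d num smul T alpha) (?N j) (c +o ?N (Suc j))"
      if "c \<in> summands F P (Suc j)" for c j
    proof -
      have c: "c \<in> ?M (Suc j)" using that DM by blast
      \<comment> \<open>The projected differential and the full one differ by a chain of the smaller
        step, so their cosets agree.\<close>
      show ?thesis
        unfolding koszul_d_coset[OF c] comp_apply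
        by (subst eq_commute, subst C.coset_eq_iff[OF N]) (rule proj[OF koszul_d_le[OF c], THEN conjunct2])
    qed
  qed
qed

lemma subcomplex_summands:
  assumes "S \<subseteq> pairs Phi Delta" "\<And>j c. c \<in> summands F S (Suc j) \<Longrightarrow> d c \<in> summands F S j"
  shows "subcomplex (cscale smul) d (koszul Phi Delta F) (summands F S)"
  unfolding subcomplex_def koszul_def
  using summands_mono[OF assms(1), where F = F] summands_subspace[OF assms(1)] assms(2)
  by (simp add: image_subset_iff)

lemma koszul_filtration:
  "subcomplex (cscale smul) (koszul_d num smul T alpha) (koszul Phi Delta F) (koszul_le Phi Delta z0 F eps)"
  "subcomplex (cscale smul) (koszul_d num smul T alpha) (koszul Phi Delta F) (koszul_less Phi Delta z0 F eps)"
  unfolding koszul_le_def koszul_less_def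
  by (rule subcomplex_summands[OF pairs_le_subset koszul_d_le], assumption)
    (rule subcomplex_summands[OF pairs_less_subset koszul_d_less], assumption)

lemma koszul_quot_d_independent:
  assumes "X \<in> koszul_quot Phi Delta z0 F eps (Suc j)"
  shows "koszul_quot_d Phi Delta z0 num smul F T alpha eps j X =
    koszul_quot_d Phi Delta z0 num smul F T alpha' eps j X"
proof -
  obtain c where c: "c \<in> summands F (pairs_le eps) (Suc j)"
    and X: "X = c +o summands F (pairs_less eps) (Suc j)"
    using assms by (auto simp: koszul_quot_def quotient_def koszul_le_def koszul_less_def)
  have "koszul_d num smul T alpha c - koszul_d num smul T alpha' c \<in> summands F (pairs_less eps) j"
    by (rule koszul_d_diff_summands[OF c]) (use pairs_remove_less in auto)
  moreover have "C.subspace (summands F (pairs_less eps) j)"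
    by (rule summands_subspace) auto
  ultimately show ?thesis
    by (simp add: koszul_quot_d_def koszul_less_def X koszul_d_coset[OF c] C.coset_eq_iff)
qed

end

theorem proposition3p4:
  fixes Phi Delta sigma0 :: "'a::real_inner set" and z0 :: 'a
    and smul :: "'r::comm_ring_1 \<Rightarrow> 'b::ab_group_add \<Rightarrow> 'b"
    and F :: "'a \<Rightarrow> 'b set" and T :: "'a \<Rightarrow> ('a \<Rightarrow>\<^sub>0 'b) \<Rightarrow> ('a \<Rightarrow>\<^sub>0 'b)"
    and num :: "'a \<Rightarrow> nat" and alpha :: "'a \<Rightarrow> 'r" and eps :: real
  assumes "vertex_coefficient_system Phi Delta sigma0 z0 smul F T"
    and "inj_on num (nabla Delta)"
  shows
    "subcomplex (cscale smul) (koszul_d num smul T alpha)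
       (koszul Phi Delta F) (koszul_le Phi Delta z0 F eps) \<and>
     subcomplex (cscale smul) (koszul_d num smul T alpha)
       (koszul Phi Delta F) (koszul_less Phi Delta z0 F eps) \<and>
     (\<forall>alpha' j. \<forall>X\<in>koszul_quot Phi Delta z0 F eps (Suc j).
       koszul_quot_d Phi Delta z0 num smul F T alpha eps j X =
       koszul_quot_d Phi Delta z0 num smul F T alpha' eps j X) \<and>
     (eps \<in> calE Phi z0 \<longrightarrow>
       represents_quotient (cscale smul)
         (summands F (pairs_eps Phi Delta z0 eps))
         (chain_proj (pairs_eps Phi Delta z0 eps) \<circ> koszul_d num smul T alpha)
         (koszul_le Phi Delta z0 F eps) (koszul_less Phi Delta z0 F eps)
         (koszul_d num smul T alpha))"
proof -
  interpret vertex_coefficient_system Phi Delta sigma0 z0 smul F T by fact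
  show ?thesis
    using koszul_filtration koszul_quot_d_independent represents_koszul_quotient
    by (simp add: koszul_le_def koszul_less_def)
qed

end
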